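(* Let $a,b\ge 1$, let $\rho$ be the canonical sequential form of a non-crossing partition of length $m$ for some $m\ge 1$, and let $\tau=1^a(\rho+1)1^b$. Put $s=\min\{a,b\}$ and $t=\max\{a,b\}$. Then the generating function $\sum_{n\ge 0}\big(\sum_{\pi\in NC_n}q^{\mu_\tau(\pi)}\big)x^n$ counting the members of $NC_n$ for $n\ge 0$ according to the number of occurrences of the subword $\tau$ is $$\frac{\left(1-x+(1-q)(1-x^s)x^{m+t}\right)\left(1-\sqrt{1-\frac{4x(1-x+(1-q)(1-x^{s-1})x^{m+t})}{1-x+(1-q)(1-x^s)x^{m+t}}}\right)}{2x\left(1-x+(1-q)(1-x^{s-1})x^{m+t}\right)}.$$
   Context: A set partition of $[n]=\{1,\dots,n\}$ with blocks $B_1,\dots,B_k$ ordered so that $\min B_1<\cdots<\min B_k$ is represented by its canonical sequential form $\pi=\pi_1\cdots\pi_n$, where $i\in B_{\pi_i}$ for each $i$; $n$ is its length. It is non-crossing if $\pi$ contains no (not necessarily consecutive) subsequence of the form $a\,b\,a\,b$ with $a<b$. $NC_n$ denotes the set of non-crossing partitions of $[n]$, identified with their canonical sequential forms ($NC_0$ consists of the empty partition). A subword pattern is a finite sequence $\tau=\tau_1\cdots\tau_k$ of positive integers whose set of distinct letters is $[\ell]$ for some $\ell$. An occurrence of $\tau$ in a sequence $\sigma_1\cdots\sigma_n$ is an index $i\in[n-k+1]$ such that the string of consecutive letters $\sigma_i\cdots\sigma_{i+k-1}$ is order-isomorphic to $\tau$ (same relative order, including equalities). $\mu_\tau(\pi)$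 denotes the number of occurrences of $\tau$ in $\pi$. $\rho+1$ is the sequence obtained by adding $1$ to each entry of $\rho$, $1^a$ is the word of $a$ ones, and juxtaposition is concatenation. The formula is an identity of formal power series in $x$ (over $\mathbb{Q}(q)$), the square root being the one with constant term $1$. *)

theory Defs
  imports
    "HOL-Library.Disjoint_Sets"
    "HOL-Library.Sublist"
    "HOL-Computational_Algebra.Computational_Algebra"
begin

definition block_of :: "nat set set \<Rightarrow> nat \<Rightarrow> nat set" where
  "block_of P i = (THE B. B \<in> P \<and> i \<in> B)"

text \<open>Blocks are numbered from 1 in increasing order of their minima, so the index of a block
  is the number of blocks whose minimum does not exceed its own.\<close>

definition block_index :: "nat set set \<Rightarrow> nat set \<Rightarrow> nat" where
  "block_index P B = card {C \<in> P. Min C \<le> Min B}"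

definition canonical_form :: "nat \<Rightarrow> nat set set \<Rightarrow> nat list" where
  "canonical_form n P = map (\<lambda>i. block_index P (block_of P i)) [1..<Suc n]"

definition noncrossing :: "nat list \<Rightarrow> bool" where
  "noncrossing w \<longleftrightarrow> \<not> (\<exists>a b. a < b \<and> subseq [a, b, a, b] w)"

definition NC :: "nat \<Rightarrow> nat list set" where
  "NC n = {canonical_form n P | P. partition_on {1..n} P \<and> noncrossing (canonical_form n P)}"

lemma finite_NC: "finite (NC n)"
proof -
  have "{P. partition_on {1..n} P} \<subseteq> Pow (Pow {1..n})"
    by (auto simp: partition_on_def)
  then have "finite {P. partition_on {1..n} P}"
    by (rule finite_subset) simp
  moreover have "NC n \<subseteq> canonical_form n ` {P. partition_on {1..n} P}"
    by (auto simp: NC_def)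
  ultimately show ?thesis
    by (meson finite_imageI finite_subset)
qed

definition order_isomorphic :: "nat list \<Rightarrow> nat list \<Rightarrow> bool" where
  "order_isomorphic u v \<longleftrightarrow> length u = length v \<and>
     (\<forall>i < length u. \<forall>j < length u.
        (u ! i < u ! j \<longleftrightarrow> v ! i < v ! j) \<and> (u ! i = u ! j \<longleftrightarrow> v ! i = v ! j))"

text \<open>Positions are counted from 0; writing the bound additively avoids truncated subtraction, so
  a word shorter than the pattern has no occurrences.\<close>

definition occurrences :: "nat list \<Rightarrow> nat list \<Rightarrow> nat" where
  "occurrences \<tau> w = card {i. i + length \<tau> \<le> length w \<and>
     order_isomorphic (take (length \<tau>) (drop i w)) \<tau>}"

text \<open>The coefficient field is the field of fractions of the polynomial ring over the rationals,
  and \<open>qvar\<close> is its generator.\<close>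

definition qvar :: "rat poly fract" where
  "qvar = to_fract [:0, 1:]"

definition NC_gf :: "nat list \<Rightarrow> rat poly fract fps" where
  "NC_gf \<tau> = Abs_fps (\<lambda>n. \<Sum>\<pi>\<in>NC n. qvar ^ occurrences \<tau> \<pi>)"

text \<open>Square root of a power series with constant term 1, normalised to have constant term 1;
  it has this meaning only for such series.\<close>

definition fps_sqrt1 :: "'a::field_char_0 fps \<Rightarrow> 'a fps" where
  "fps_sqrt1 f = fps_radical (\<lambda>_ _. 1) 2 f"

lemma fps_sqrt1_square: "f $ 0 = 1 \<Longrightarrow> fps_sqrt1 f ^ 2 = f"
  and fps_sqrt1_nth_0: "fps_sqrt1 f $ 0 = 1"
  using power_radical[of f "\<lambda>_ _. 1" 1] by (simp_all add: fps_sqrt1_def numeral_2_eq_2)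

end

(*
  A nonempty non-crossing word is 1 v_1 1 v_2 ... 1 v_k, where the v_i contain no 1; because no
  letter can occur in two of them, each v_i is a shifted non-crossing word u_i, and every sequence
  u_1, ..., u_k arises. An occurrence c^a r c^b of the pattern has its least letter at both ends,
  so it either lies inside one v_i, or c = 1 and it is a factor E^(a-1) R E^(b-1) of the sequence
  (u_i) that is followed by a further term, where E is the empty word and R = rho.
  Let F be the generating function of the words, and G that of the sequences, where each sequence
  is weighted as if a further term followed; then F = 1 + x F G. Without the further term the
  sequences are weighted like the words, and the term adds an occurrence exactly to those that end
  in E^(a-1) R E^(b-1). Hence G = F + (q - 1) x^(b+m) K, where K counts the sequences z E^(a-1) in
  the same way as G, and the occurrences that end inside E^(a-1) express K through G.
  Eliminating G and K leaves B (F - 1) = x A F^2, where A and B are the second and the first of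
  the two polynomial expressions in the theorem.
*)
theory Submission
  imports Defs
begin

subsection \<open>Sums of locally finite families of power series\<close>

text \<open>The words and the sequences form infinite index sets, but each coefficient receives only
  finitely many terms. Summing coefficientwise lets bijections and products of index sets act on
  whole series.\<close>

definition fps_locally_finite :: "('i \<Rightarrow> 'a::comm_ring_1 fps) \<Rightarrow> 'i set \<Rightarrow> bool" where
  "fps_locally_finite f S \<longleftrightarrow> (\<forall>n. finite {i \<in> S. f i $ n \<noteq> 0})"

text \<open>Only the indices that contribute to a given coefficient are summed. With infinitely many
  of them \<open>sum\<close> would return 0, so the value is meaningful for locally finite
  families.\<close>

definition fps_infsum :: "('i \<Rightarrow> 'a::comm_ring_1 fps) \<Rightarrow> 'i set \<Rightarrow> 'a fps" where
  "fps_infsum f S = Abs_fps (\<lambda>n. \<Sum>i \<in> {i \<in> S. f i $ n \<noteq> 0}. f i $ n)"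

lemma fps_infsum_nth:
  assumes "finite T" "T \<subseteq> S" "{i \<in> S. f i $ n \<noteq> 0} \<subseteq> T"
  shows "fps_infsum f S $ n = (\<Sum>i\<in>T. f i $ n)"
  unfolding fps_infsum_def fps_nth_Abs_fps
  by (rule sum.mono_neutral_left) (use assms in auto)

lemma fps_locally_finite_below:
  assumes "fps_locally_finite f S"
  shows "finite {i \<in> S. \<exists>k\<le>n. f i $ k \<noteq> 0}"
proof -
  have "{i \<in> S. \<exists>k\<le>n. f i $ k \<noteq> 0} = (\<Union>k\<le>n. {i \<in> S. f i $ k \<noteq> 0})" by auto
  then show ?thesis using assms by (simp add: fps_locally_finite_def)
qed

lemma fps_locally_finiteI:
  assumes "\<And>n. finite (A n)" "\<And>n. {i \<in> S. f i $ n \<noteq> 0} \<subseteq> A n"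
  shows "fps_locally_finite f S"
  unfolding fps_locally_finite_def using finite_subset[OF assms(2) assms(1)] by blast

lemma fps_locally_finite_mono:
  assumes "fps_locally_finite f S" "T \<subseteq> S"
  shows "fps_locally_finite f T"
  by (rule fps_locally_finiteI[of "\<lambda>n. {i \<in> S. f i $ n \<noteq> 0}"])
    (use assms in \<open>auto simp: fps_locally_finite_def\<close>)

lemma fps_locally_finite_finite: "finite S \<Longrightarrow> fps_locally_finite f S"
  by (simp add: fps_locally_finite_def)

lemma fps_infsum_reindex:
  assumes "bij_betw h S T"
  shows "fps_infsum f T = fps_infsum (\<lambda>i. f (h i)) S"
proof (rule fps_ext)
  fix n
  have "bij_betw h {i \<in> S. f (h i) $ n \<noteq> 0} {i \<in> T. f i $ n \<noteq> 0}"
    using assms unfolding bij_betw_def by (auto simp: inj_on_def)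
  from sum.reindex_bij_betw[OF this, of "\<lambda>i. f i $ n"]
  show "fps_infsum f T $ n = fps_infsum (\<lambda>i. f (h i)) S $ n"
    by (simp add: fps_infsum_def)
qed

lemma fps_infsum_cong: "(\<And>i. i \<in> S \<Longrightarrow> f i = g i) \<Longrightarrow> fps_infsum f S = fps_infsum g S"
  unfolding fps_infsum_def by (intro arg_cong[where f = Abs_fps] ext sum.cong) auto

lemma fps_infsum_finite: "finite S \<Longrightarrow> fps_infsum f S = sum f S"
  by (intro fps_ext) (simp add: fps_infsum_nth[of S] fps_sum_nth)

lemma fps_infsum_Un_disjoint:
  assumes "fps_locally_finite f S" "fps_locally_finite f T" "S \<inter> T = {}"
  shows "fps_infsum f (S \<union> T) = fps_infsum f S + fps_infsum f T"
proof (rule fps_ext)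
  fix n
  have eq: "{i \<in> S \<union> T. f i $ n \<noteq> 0} = {i \<in> S. f i $ n \<noteq> 0} \<union> {i \<in> T. f i $ n \<noteq> 0}"
    by auto
  show "fps_infsum f (S \<union> T) $ n = (fps_infsum f S + fps_infsum f T) $ n"
    unfolding fps_infsum_def fps_nth_Abs_fps fps_add_nth eq
    by (rule sum.union_disjoint) (use assms in \<open>auto simp: fps_locally_finite_def\<close>)
qed

lemma fps_infsum_add:
  assumes "fps_locally_finite f S" "fps_locally_finite g S"
  shows "fps_infsum (\<lambda>i. f i + g i) S = fps_infsum f S + fps_infsum g S"
proof (rule fps_ext)
  fix n
  define T where "T = {i \<in> S. f i $ n \<noteq> 0} \<union> {i \<in> S. g i $ n \<noteq> 0}"
  have T: "finite T" "T \<subseteq> S" using assms by (auto simp: T_def fps_locally_finite_def)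
  have "fps_infsum (\<lambda>i. f i + g i) S $ n = (\<Sum>i\<in>T. (f i + g i) $ n)"
    by (rule fps_infsum_nth) (use T in \<open>auto simp: T_def\<close>)
  moreover have "fps_infsum f S $ n = (\<Sum>i\<in>T. f i $ n)" "fps_infsum g S $ n = (\<Sum>i\<in>T. g i $ n)"
    by (rule fps_infsum_nth; use T in \<open>auto simp: T_def\<close>)+
  ultimately show "fps_infsum (\<lambda>i. f i + g i) S $ n = (fps_infsum f S + fps_infsum g S) $ n"
    by (simp add: sum.distrib)
qed

lemma fps_mult_support:
  assumes "((f :: 'a::comm_ring_1 fps) * g) $ n \<noteq> 0"
  shows "(\<exists>k\<le>n. f $ k \<noteq> 0) \<and> (\<exists>k\<le>n. g $ k \<noteq> 0)"
proof -
  obtain i where "i \<le> n" "f $ i * g $ (n - i) \<noteq> 0"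
    using assms unfolding fps_mult_nth by (auto elim!: sum.not_neutral_contains_not_neutral)
  then show ?thesis by (auto intro: exI[of _ i] exI[of _ "n - i"])
qed

lemma
  assumes "fps_locally_finite f S" "fps_locally_finite g T"
  shows fps_locally_finite_times: "fps_locally_finite (\<lambda>(i, j). f i * g j) (S \<times> T)"
    and fps_infsum_times: "fps_infsum (\<lambda>(i, j). f i * g j) (S \<times> T) = fps_infsum f S * fps_infsum g T"
proof -
  \<comment> \<open>Coefficient \<open>n\<close> of a product involves only coefficients up to
    \<open>n\<close> of the factors, so \<open>A n\<close> and \<open>B n\<close> contain every
    index that matters.\<close>
  define A where "A n = {i \<in> S. \<exists>k\<le>n. f i $ k \<noteq> 0}" for n
  define B where "B n = {i \<in> T. \<exists>k\<le>n. g i $ k \<noteq> 0}" for n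
  have fin: "finite (A n)" "finite (B n)" for n
    using assms by (auto simp: A_def B_def fps_locally_finite_below)
  have sub: "{p \<in> S \<times> T. (case p of (i, j) \<Rightarrow> f i * g j) $ n \<noteq> 0} \<subseteq> A n \<times> B n" for n
    by (auto simp: A_def B_def dest: fps_mult_support)
  show "fps_locally_finite (\<lambda>(i, j). f i * g j) (S \<times> T)"
    by (rule fps_locally_finiteI[OF _ sub]) (use fin in simp)
  show "fps_infsum (\<lambda>(i, j). f i * g j) (S \<times> T) = fps_infsum f S * fps_infsum g T"
  proof (rule fps_ext)
    fix n
    have "fps_infsum f S $ k = (\<Sum>i\<in>A n. f i $ k)" if "k \<le> n" for k
      by (rule fps_infsum_nth) (use that fin in \<open>auto simp: A_def\<close>)
    then have fk: "fps_infsum f S $ k = sum f (A n) $ k" if "k \<le> n" for k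
      using that by (simp add: fps_sum_nth)
    have "fps_infsum g T $ k = (\<Sum>i\<in>B n. g i $ k)" if "k \<le> n" for k
      by (rule fps_infsum_nth) (use that fin in \<open>auto simp: B_def\<close>)
    then have gk: "fps_infsum g T $ k = sum g (B n) $ k" if "k \<le> n" for k
      using that by (simp add: fps_sum_nth)
    have "fps_infsum (\<lambda>(i, j). f i * g j) (S \<times> T) $ n
        = (\<Sum>p\<in>A n \<times> B n. (case p of (i, j) \<Rightarrow> f i * g j) $ n)"
      by (rule fps_infsum_nth) (use fin sub in \<open>auto simp: A_def B_def\<close>)
    also have "\<dots> = (sum f (A n) * sum g (B n)) $ n"
      by (simp add: sum_product sum.cartesian_product fps_sum_nth case_prod_unfold)
    also have "\<dots> = (fps_infsum f S * fps_infsum g T) $ n"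
      by (simp add: fps_mult_nth fk gk)
    finally show "fps_infsum (\<lambda>(i, j). f i * g j) (S \<times> T) $ n = (fps_infsum f S * fps_infsum g T) $ n" .
  qed
qed

lemma
  assumes "fps_locally_finite f S"
  shows fps_locally_finite_cmult: "fps_locally_finite (\<lambda>i. c * f i) S"
    and fps_infsum_cmult: "fps_infsum (\<lambda>i. c * f i) S = c * fps_infsum f S"
proof -
  have "{i \<in> S. (c * f i) $ n \<noteq> 0} \<subseteq> {i \<in> S. \<exists>k\<le>n. f i $ k \<noteq> 0}" for n
    by (auto dest: fps_mult_support)
  then show "fps_locally_finite (\<lambda>i. c * f i) S"
    by (rule fps_locally_finiteI[OF fps_locally_finite_below[OF assms]])
  \<comment> \<open>The constant is read as a family over a one-element index set, which makes this
    a case of the product rule.\<close>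
  have "bij_betw (Pair ()) S ({()} \<times> S)" by (auto simp: bij_betw_def inj_on_def)
  from fps_infsum_reindex[OF this, of "\<lambda>(u, i). c * f i"]
  show "fps_infsum (\<lambda>i. c * f i) S = c * fps_infsum f S"
    using fps_infsum_times[of "\<lambda>_::unit. c" "{()}" f S] assms
    by (simp add: fps_locally_finite_finite fps_infsum_finite)
qed

text \<open>Turns the indicator of a match, which appears as a factor, into a restriction of the
  index set.\<close>

lemma fps_infsum_of_bool:
  "fps_infsum (\<lambda>i. of_bool (P i) * f i) S = fps_infsum f {i \<in> S. P i}"
proof (rule fps_ext)
  fix n
  have "{i \<in> S. (of_bool (P i) * f i) $ n \<noteq> 0} = {i \<in> {i \<in> S. P i}. f i $ n \<noteq> 0}"
    by (auto simp: of_bool_def)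
  then show "fps_infsum (\<lambda>i. of_bool (P i) * f i) S $ n = fps_infsum f {i \<in> S. P i} $ n"
    unfolding fps_infsum_def by (auto intro!: sum.cong)
qed

subsection \<open>Restricted growth functions\<close>

text \<open>This is the usual growth condition that every letter is positive and exceeds the maximum
  of the preceding ones by at most 1. Stated through prefixes, it passes to prefixes and can be
  checked letter by letter from the right.\<close>

definition rgf :: "nat list \<Rightarrow> bool" where
  "rgf w \<longleftrightarrow> (\<forall>p. prefix p w \<longrightarrow> (\<exists>k. set p = {1..k}))"

lemma rgf_prefix: "rgf w \<Longrightarrow> prefix p w \<Longrightarrow> rgf p"
  unfolding rgf_def by (meson prefix_order.trans)

lemma rgf_Nil [simp]: "rgf []"
  by (auto simp: rgf_def intro: exI[of _ 0])

lemma rgf_set: "rgf w \<Longrightarrow> \<exists>k. set w = {1..k}"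
  by (auto simp: rgf_def)

lemma rgf_snoc: "rgf (w @ [c]) \<longleftrightarrow> rgf w \<and> (\<exists>k. insert c (set w) = {1..k})"
  by (auto simp: rgf_def)

text \<open>Deleting the maximum leaves all other ranks unchanged, and the maximum has rank
  \<open>card S\<close>. Applied to the minima of blocks, this shows that the block numbers have no
  gaps.\<close>

lemma rank_image:
  fixes S :: "nat set"
  assumes "finite S"
  shows "(\<lambda>x. card {y \<in> S. y \<le> x}) ` S = {1..card S}"
  using assms
proof (induction "card S" arbitrary: S)
  case 0
  then show ?case by simp
next
  case (Suc n)
  then have S: "finite S" "S \<noteq> {}" by auto
  define M T where "M = Max S" and "T = S - {M}"
  have M: "M \<in> S" "\<And>y. y \<in> S \<Longrightarrow> y \<le> M" using S by (auto simp: M_def)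
  have "card T = n" using M S Suc.hyps(2) by (simp add: T_def)
  then have IH: "(\<lambda>x. card {y \<in> T. y \<le> x}) ` T = {1..n}"
    using Suc.hyps(1)[of T] S by (simp add: T_def)
  define f where "f x = card {y \<in> S. y \<le> x}" for x
  have "{y \<in> S. y \<le> x} = {y \<in> T. y \<le> x}" if "x \<in> T" for x
    using that M by (fastforce simp: T_def)
  then have "f ` T = {1..n}"
    using IH by (simp add: f_def cong: image_cong)
  moreover have "{y \<in> S. y \<le> M} = S" using M by auto
  then have "f M = Suc n" using Suc.hyps(2) by (simp add: f_def)
  moreover have "S = insert M T" using M by (auto simp: T_def)
  then have "f ` S = insert (f M) (f ` T)" by blast
  ultimately have "(\<lambda>x. card {y \<in> S. y \<le> x}) ` S = insert (Suc n) {1..n}"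
    by (simp add: f_def)
  then show ?case using Suc.hyps(2) by auto
qed

section \<open>Canonical forms of set partitions as restricted growth functions\<close>

context
  fixes P :: "nat set set" and n :: nat
  assumes P: "partition_on {1..n} P"
begin

lemma partition_finite: "finite P" "B \<in> P \<Longrightarrow> finite B"
proof -
  show "finite P" using finite_elements[OF _ P] by simp
  have "\<Union>P = {1..n}" using P by (simp add: partition_on_def)
  then show "B \<in> P \<Longrightarrow> finite B" by (metis Sup_upper finite_atLeastAtMost finite_subset)
qed

lemma Min_block: "B \<in> P \<Longrightarrow> Min B \<in> B"
  using P partition_finite(2) by (intro Min_in) (auto simp: partition_on_def)

lemma block_of_eq: "B \<in> P \<Longrightarrow> i \<in> B \<Longrightarrow> block_of P i = B"
  unfolding block_of_def using P by (intro the_equality) (auto simp: partition_on_def disjoint_def)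

lemma block_of_in:
  assumes "i \<in> {1..n}"
  shows "block_of P i \<in> P" "i \<in> block_of P i"
proof -
  have "i \<in> \<Union>P" using assms P by (simp add: partition_on_def)
  then obtain B where "B \<in> P" "i \<in> B" by blast
  then show "block_of P i \<in> P" "i \<in> block_of P i" by (simp_all add: block_of_eq)
qed

lemma Min_inj_on: "inj_on Min P"
  by (rule inj_onI) (metis Min_block block_of_eq)

text \<open>The blocks met by the first \<open>j\<close> elements come first in the numbering, so
  their numbers form an initial interval.\<close>

lemma set_take_canonical_form:
  assumes "j \<le> n"
  shows "\<exists>k. set (take j (canonical_form n P)) = {1..k}"
proof -
  define Q where "Q = {B \<in> P. Min B \<le> j}"
  define S where "S = Min ` Q"
  \<comment> \<open>Every block whose minimum is at most that of a member of \<open>Q\<close> is in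
    \<open>Q\<close> too, and minima are distinct, so the block number is a rank within
    \<open>S\<close>.\<close>
  have idx: "block_index P B = card {y \<in> S. y \<le> Min B}" if "B \<in> Q" for B
  proof -
    have "{y \<in> S. y \<le> Min B} = Min ` {C \<in> P. Min C \<le> Min B}"
      using that by (auto simp: S_def Q_def)
    moreover have "inj_on Min {C \<in> P. Min C \<le> Min B}"
      using Min_inj_on by (rule inj_on_subset) auto
    ultimately show ?thesis by (simp add: block_index_def card_image)
  qed
  have Q: "block_of P ` {1..j} = Q"
  proof (intro equalityI subsetI)
    fix B assume "B \<in> block_of P ` {1..j}"
    then obtain i where i: "i \<in> {1..j}" "B = block_of P i" by blast
    then have "B \<in> P" "i \<in> B" using block_of_in[of i] assms by auto
    then show "B \<in> Q" using i Min_le[OF partition_finite(2)] by (fastforce simp: Q_def)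
  next
    fix B assume "B \<in> Q"
    then have B: "B \<in> P" "Min B \<in> B" "Min B \<le> j" by (auto simp: Q_def Min_block)
    then have "Min B \<in> {1..n}" using P by (auto simp: partition_on_def)
    then have "Min B \<in> {1..j}" using B by simp
    then show "B \<in> block_of P ` {1..j}" using block_of_eq[OF B(1,2)] by force
  qed
  have "take j [1..<Suc n] = [1..<Suc j]" using assms by (simp add: take_upt del: upt_Suc)
  then have "set (take j (canonical_form n P)) = block_index P ` (block_of P ` {1..j})"
    by (simp add: canonical_form_def take_map image_image atLeastLessThanSuc_atLeastAtMost del: upt_Suc)
  also have "\<dots> = (\<lambda>B. card {y \<in> S. y \<le> Min B}) ` Q"
    unfolding Q using idx by (intro image_cong) auto
  also have "\<dots> = (\<lambda>x. card {y \<in> S. y \<le> x}) ` S" by (simp add: S_def image_image)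
  also have "\<dots> = {1..card S}"
    by (rule rank_image) (simp add: S_def Q_def partition_finite(1))
  finally show ?thesis by blast
qed

lemma rgf_canonical_form: "rgf (canonical_form n P)"
  unfolding rgf_def
proof (intro allI impI)
  fix p assume "prefix p (canonical_form n P)"
  then have "take (length p) (canonical_form n P) = p"
    by (auto simp: prefix_def)
  moreover have "length p \<le> n"
    using prefix_length_le[OF \<open>prefix p (canonical_form n P)\<close>]
    by (simp add: canonical_form_def del: upt_Suc)
  ultimately show "\<exists>k. set p = {1..k}"
    using set_take_canonical_form[of "length p"] by simp
qed

end

text \<open>The blocks are the sets of positions of equal letters. Restricted growth makes first
  occurrences appear in increasing order of the letters, so numbering the blocks returns the
  letters.\<close>

lemma rgf_is_canonical_form:
  assumes w: "rgf w" and n: "length w = n"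
  shows "\<exists>P. partition_on {1..n} P \<and> canonical_form n P = w"
proof (intro exI conjI)
  define B where "B c = {i \<in> {1..n}. w ! (i - 1) = c}" for c
  define P where "P = B ` set w"
  obtain k where k: "set w = {1..k}" using rgf_set[OF w] by blast
  have ne: "B c \<noteq> {}" if c: "c \<in> set w" for c
  proof -
    obtain j where "j < n" "w ! j = c" using c n by (auto simp: in_set_conv_nth)
    then have "Suc j \<in> B c" by (auto simp: B_def)
    then show ?thesis by blast
  qed
  show P: "partition_on {1..n} P"
    unfolding partition_on_def
  proof (intro conjI)
    have "w ! (i - 1) \<in> set w" if "i \<in> {1..n}" for i using that n by (intro nth_mem) auto
    then show "\<Union>P = {1..n}" unfolding P_def B_def by blast
    show "disjoint P" by (auto simp: P_def B_def disjoint_def)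
    show "{} \<notin> P" using ne by (auto simp: P_def)
  qed
  have MinB: "Min (B c) \<in> B c" if "c \<in> set w" for c
    using ne[OF that] by (intro Min_in) (auto simp: B_def)
  have less: "Min (B c) < Min (B d)" if "c \<in> set w" "d \<in> set w" "c < d" for c d
  proof -
    define j where "j = Min (B d)"
    have j: "j \<in> {1..n}" "w ! (j - 1) = d" using MinB[OF that(2)] by (auto simp: B_def j_def)
    \<comment> \<open>The letters up to the first \<open>d\<close> form an initial interval
      containing \<open>d\<close>, so the smaller letter \<open>c\<close> has already
      occurred.\<close>
    obtain l where l: "set (take j w) = {1..l}"
      using w by (meson rgf_def take_is_prefix)
    have "d \<in> set (take j w)" using j n by (auto simp: in_set_conv_nth intro!: exI[of _ "j - 1"])
    then have "c \<in> set (take j w)" using l that(3) that(1) k by auto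
    then obtain i where i: "i < j" "w ! i = c" using j n by (auto simp: in_set_conv_nth)
    then have "Suc i \<in> B c" using j by (auto simp: B_def)
    then have "Min (B c) \<le> Suc i" by (intro Min_le) (auto simp: B_def)
    moreover have "Min (B c) \<noteq> j" using MinB[OF that(1)] j that(3) by (auto simp: B_def)
    ultimately show ?thesis using i by (simp add: j_def)
  qed
  have idx: "block_index P (B c) = c" if "c \<in> set w" for c
  proof -
    have le: "Min (B d) \<le> Min (B c) \<longleftrightarrow> d \<le> c" if "d \<in> set w" for d
      using less[of c d] less[of d c] that \<open>c \<in> set w\<close>
      by (cases d c rule: linorder_cases) auto
    have "{C \<in> P. Min C \<le> Min (B c)} = B ` {1..c}"
      using le that k by (auto simp: P_def)
    moreover have "inj_on B {1..c}"
    proof (rule inj_onI)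
      fix d e assume "d \<in> {1..c}" "e \<in> {1..c}" "B d = B e"
      then show "d = e" using MinB[of d] that k by (auto simp: B_def)
    qed
    ultimately show ?thesis by (simp add: block_index_def card_image)
  qed
  show "canonical_form n P = w"
  proof (rule nth_equalityI)
    show "length (canonical_form n P) = length w" by (simp add: canonical_form_def n)
    fix i assume "i < length (canonical_form n P)"
    then have i: "i < n" by (simp add: canonical_form_def del: upt_Suc)
    then have wi: "w ! i \<in> set w" using n by simp
    have "block_of P (Suc i) = B (w ! i)"
      by (rule block_of_eq[OF P]) (use i wi in \<open>auto simp: P_def B_def\<close>)
    then show "canonical_form n P ! i = w ! i"
      using i idx[OF wi] by (simp add: canonical_form_def del: upt_Suc)
  qed
qed

text \<open>From here on words replace set partitions.\<close>

lemma NC_iff: "w \<in> NC n \<longleftrightarrow> length w = n \<and> rgf w \<and> noncrossing w"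
proof
  assume "w \<in> NC n"
  then show "length w = n \<and> rgf w \<and> noncrossing w"
    by (auto simp: NC_def rgf_canonical_form) (simp add: canonical_form_def)
next
  assume "length w = n \<and> rgf w \<and> noncrossing w"
  moreover from this obtain P where "partition_on {1..n} P" "canonical_form n P = w"
    using rgf_is_canonical_form[of w n] by blast
  ultimately have "w = canonical_form n P \<and> partition_on {1..n} P \<and> noncrossing (canonical_form n P)"
    by simp
  then show "w \<in> NC n" unfolding NC_def by blast
qed

subsection \<open>Decomposing a non-crossing word at its ones\<close>

definition NCW :: "nat list set" where
  "NCW = {w. rgf w \<and> noncrossing w}"

text \<open>The maximum of \<open>w @ [1]\<close>: inserting 1 gives the empty word the value 1, the
  right shift for a segment behind the first 1.\<close>

definition top_letter :: "nat list \<Rightarrow> nat" where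
  "top_letter w = Max (insert 1 (set w))"

text \<open>The segments are listed from right to left, so that the shift of the first one depends only
  on the rest of the list.\<close>

fun assemble :: "nat list list \<Rightarrow> nat list" where
  "assemble [] = []"
| "assemble (u # us) = assemble us @ 1 # map (\<lambda>c. c + top_letter (assemble us)) u"

lemma Nil_in_NCW: "[] \<in> NCW"
  by (simp add: NCW_def noncrossing_def)

lemma top_letter_ge: "1 \<le> top_letter w" "c \<in> set w \<Longrightarrow> c \<le> top_letter w"
  by (simp_all add: top_letter_def)

lemma rgf_ge_1: "rgf w \<Longrightarrow> c \<in> set w \<Longrightarrow> 1 \<le> c"
  using rgf_set by fastforce

lemma rgf_insert_1:
  assumes "rgf w"
  shows "insert 1 (set w) = {1..top_letter w}"
proof -
  obtain k where k: "set w = {1..k}" using rgf_set[OF assms] by blast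
  then have "insert 1 (set w) = {1..max 1 k}" by auto
  moreover have "Max {1..max 1 k} = max 1 k" by (intro Max_eqI) auto
  ultimately show ?thesis by (simp add: top_letter_def)
qed

lemma rgf_append_1:
  assumes "rgf w"
  shows "rgf (w @ [1])"
  using assms rgf_insert_1[OF assms] by (auto simp: rgf_snoc)

text \<open>As \<open>0\<close> is not in \<open>X\<close>, the shifted copy lies strictly above
  \<open>d\<close>. A positive \<open>x\<close> is therefore in \<open>X\<close> exactly when
  \<open>x + d\<close> is in the union.\<close>

lemma shift_interval:
  fixes X :: "nat set"
  assumes "0 \<notin> X"
  shows "(\<exists>k. {1..d} \<union> (\<lambda>c. c + d) ` X = {1..k}) \<longleftrightarrow> (\<exists>k. X = {1..k})"
proof
  assume "\<exists>k. {1..d} \<union> (\<lambda>c. c + d) ` X = {1..k}"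
  then obtain k where k: "{1..d} \<union> (\<lambda>c. c + d) ` X = {1..k}" by blast
  have "x \<in> X \<longleftrightarrow> x \<in> {1..k - d}" for x
  proof -
    have "x \<in> X \<longleftrightarrow> 1 \<le> x \<and> x + d \<in> {1..d} \<union> (\<lambda>c. c + d) ` X"
      using assms by (cases "x = 0") auto
    also have "\<dots> \<longleftrightarrow> x \<in> {1..k - d}" unfolding k by auto
    finally show ?thesis .
  qed
  then show "\<exists>k. X = {1..k}" by blast
next
  assume "\<exists>k. X = {1..k}"
  then obtain k where "X = {1..k}" by blast
  then have "x \<in> {1..d} \<union> (\<lambda>c. c + d) ` X \<longleftrightarrow> x \<in> {1..k + d}" for x
    by (auto simp: image_iff intro!: bexI[of _ "x - d"])
  then show "\<exists>k. {1..d} \<union> (\<lambda>c. c + d) ` X = {1..k}" by blast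
qed

text \<open>The letters of \<open>w @ [1]\<close> fill \<open>{1..d}\<close>. Adding the letters of
  \<open>u\<close> one at a time, each prefix condition reduces to the one for \<open>u\<close> by
  \<open>shift_interval\<close>.\<close>

lemma rgf_append_shift:
  assumes "rgf w" "0 \<notin> set u"
  shows "rgf (w @ 1 # map (\<lambda>c. c + top_letter w) u) \<longleftrightarrow> rgf u"
proof -
  define d where "d = top_letter w"
  have d: "set (w @ [1]) = {1..d}"
    using rgf_insert_1[OF assms(1)] by (auto simp: d_def)
  have "rgf (w @ 1 # map (\<lambda>c. c + d) u) \<longleftrightarrow> rgf u"
    using assms(2)
  proof (induction u rule: rev_induct)
    case Nil
    then show ?case using rgf_append_1[OF assms(1)] by simp
  next
    case (snoc c u)
    have S: "insert (c + d) (set (w @ 1 # map (\<lambda>c. c + d) u)) = {1..d} \<union> (\<lambda>c. c + d) ` insert c (set u)"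
      using d by auto
    have "w @ 1 # map (\<lambda>c. c + d) (u @ [c]) = (w @ 1 # map (\<lambda>c. c + d) u) @ [c + d]"
      by simp
    then have "rgf (w @ 1 # map (\<lambda>c. c + d) (u @ [c])) \<longleftrightarrow>
       rgf u \<and> (\<exists>k. {1..d} \<union> (\<lambda>c. c + d) ` insert c (set u) = {1..k})"
      using snoc by (simp only: rgf_snoc S) simp
    also have "\<dots> \<longleftrightarrow> rgf (u @ [c])"
      using snoc.prems by (subst shift_interval) (auto simp: rgf_snoc)
    finally show ?case .
  qed
  then show ?thesis by (simp add: d_def)
qed

section \<open>Non-crossing words under shifts and concatenation\<close>

lemma subseq_set_subset: "subseq v w \<Longrightarrow> set v \<subseteq> set w"
  by (induction rule: list_emb.induct) auto

lemma noncrossing_subseq: "noncrossing w \<Longrightarrow> subseq v w \<Longrightarrow> noncrossing v"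
  unfolding noncrossing_def by (meson subseq_order.trans)

lemma noncrossing_shift: "noncrossing (map (\<lambda>c. c + d) u) \<longleftrightarrow> noncrossing u"
proof
  assume L: "noncrossing (map (\<lambda>c. c + d) u)"
  show "noncrossing u"
    unfolding noncrossing_def
  proof
    assume "\<exists>a b. a < b \<and> subseq [a, b, a, b] u"
    then obtain a b where "a < b" "subseq [a, b, a, b] u" by blast
    then have "a + d < b + d" "subseq [a + d, b + d, a + d, b + d] (map (\<lambda>c. c + d) u)"
      using subseq_map[of "[a, b, a, b]" u "\<lambda>c. c + d"] by simp_all
    then show False using L unfolding noncrossing_def by blast
  qed
next
  assume R: "noncrossing u"
  show "noncrossing (map (\<lambda>c. c + d) u)"
    unfolding noncrossing_def
  proof
    assume "\<exists>a b. a < b \<and> subseq [a, b, a, b] (map (\<lambda>c. c + d) u)"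
    then obtain a b where ab: "a < b" "subseq [a, b, a, b] (map (\<lambda>c. c + d) u)" by blast
    have "{a, b} \<subseteq> set (map (\<lambda>c. c + d) u)"
      using subseq_set_subset[OF ab(2)] by simp
    then have "d \<le> a" "d \<le> b" by auto
    moreover have "subseq [a - d, b - d, a - d, b - d] u"
      using subseq_map[OF ab(2), of "\<lambda>c. c - d"] by (simp add: comp_def)
    moreover from calculation ab(1) have "a - d < b - d" by simp
    ultimately show False using R unfolding noncrossing_def by blast
  qed
qed

text \<open>However \<open>a b a b\<close> is cut into two nonempty pieces, one of its letters lies
  in both, whereas all letters of \<open>v\<close> exceed those before it.\<close>

lemma noncrossing_append:
  assumes y: "noncrossing (y @ [1])" and v: "noncrossing v"
    and less: "\<And>c d. c \<in> set (y @ [1]) \<Longrightarrow> d \<in> set v \<Longrightarrow> c < d"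
  shows "noncrossing (y @ 1 # v)"
  unfolding noncrossing_def
proof
  assume "\<exists>a b. a < b \<and> subseq [a, b, a, b] (y @ 1 # v)"
  then obtain a b where ab: "a < b" "subseq [a, b, a, b] ((y @ [1]) @ v)"
    unfolding append_assoc append_Cons append_Nil by blast
  then obtain p q where pq: "[a, b, a, b] = p @ q" "subseq p (y @ [1])" "subseq q v"
    using subseq_appendE[OF ab(2)] by blast
  have sets: "set p \<subseteq> set (y @ [1])" "set q \<subseteq> set v"
    using subseq_set_subset[OF pq(2)] subseq_set_subset[OF pq(3)] .
  from pq(1) consider "p = [a, b, a, b]" | "q = [a, b, a, b]" | "a \<in> set p" "a \<in> set q"
    | "b \<in> set p" "b \<in> set q"
    by (auto simp: Cons_eq_append_conv)
  then show False
  proof cases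
    case 1
    then show False using pq(2) y ab(1) unfolding noncrossing_def by blast
  next
    case 2
    then show False using pq(3) v ab(1) unfolding noncrossing_def by blast
  qed (use sets less in blast)+
qed

lemma shift_gt:
  assumes "0 \<notin> set u" "c \<in> set (w @ [1])" "d \<in> set (map (\<lambda>c. c + top_letter w) u)"
  shows "c < d"
proof -
  have "c \<le> top_letter w" using assms(2) top_letter_ge by auto
  moreover have "top_letter w < d" using assms(1,3) by (auto intro: gr0I)
  ultimately show ?thesis by simp
qed

lemma NCW_0: "u \<in> NCW \<Longrightarrow> 0 \<notin> set u"
  using rgf_ge_1[of u 0] by (auto simp: NCW_def)

text \<open>The new 1 could only be the final \<open>b\<close> of a crossing, and no positive
  \<open>a\<close> is below 1.\<close>

lemma noncrossing_append_1:
  assumes "noncrossing y" "0 \<notin> set y"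
  shows "noncrossing (y @ [1])"
  unfolding noncrossing_def
proof
  assume "\<exists>a b. a < b \<and> subseq [a, b, a, b] (y @ [1])"
  then obtain a b where ab: "a < b" "subseq [a, b, a, b] (y @ [1])" by blast
  then obtain p q where pq: "[a, b, a, b] = p @ q" "subseq p y" "subseq q [1]"
    using subseq_appendE[OF ab(2)] by blast
  show False
  proof (cases "q = []")
    case True
    then show False using pq ab(1) assms(1) unfolding noncrossing_def by auto
  next
    case False
    have "last q = b" using pq(1) False by (metis last.simps last_appendR list.distinct(1))
    then have "b = 1" using subseq_set_subset[OF pq(3)] last_in_set[OF False] by auto
    moreover have "a \<in> set (y @ [1])" using subseq_set_subset[OF ab(2)] by simp
    ultimately show False using ab(1) assms(2) by auto
  qed
qed

lemma NCW_append_shift: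
  assumes "y \<in> NCW" "u \<in> NCW"
  shows "y @ 1 # map (\<lambda>c. c + top_letter y) u \<in> NCW"
proof -
  have "noncrossing (y @ 1 # map (\<lambda>c. c + top_letter y) u)"
  proof (rule noncrossing_append)
    show "noncrossing (y @ [1])"
      using assms(1) NCW_0 by (intro noncrossing_append_1) (auto simp: NCW_def)
    show "noncrossing (map (\<lambda>c. c + top_letter y) u)"
      using assms(2) by (simp add: noncrossing_shift NCW_def)
  qed (rule shift_gt[OF NCW_0[OF assms(2)]])
  then show ?thesis
    using assms rgf_append_shift[of y u] NCW_0[OF assms(2)] by (simp add: NCW_def)
qed

text \<open>A letter \<open>c\<close> common to \<open>y\<close> and \<open>v\<close> would give the
  crossing \<open>1 c 1 c\<close>, formed with the initial 1 of \<open>y\<close> and the 1 in front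
  of \<open>v\<close>. Hence all letters of \<open>v\<close> are new, and so they exceed those of
  \<open>y\<close>.\<close>

lemma NCW_split_last_1:
  assumes w: "y @ 1 # v \<in> NCW" and v: "1 \<notin> set v"
  shows "y \<in> NCW \<and> (\<exists>u\<in>NCW. v = map (\<lambda>c. c + top_letter y) u)"
proof -
  have pre: "rgf p" if "prefix p (y @ 1 # v)" for p
    using w rgf_prefix that by (auto simp: NCW_def)
  have y: "rgf y" by (rule pre) simp
  have nc: "noncrossing (y @ 1 # v)" using w by (simp add: NCW_def)
  have "subseq y (y @ 1 # v)" by (intro prefix_imp_subseq) simp
  then have yN: "y \<in> NCW" using y noncrossing_subseq[OF nc] by (simp add: NCW_def)
  have gt: "top_letter y < c" if c: "c \<in> set v" for c
  proof (rule ccontr)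
    assume "\<not> top_letter y < c"
    moreover have "1 \<le> c" using rgf_ge_1[of "y @ 1 # v" c] w c by (simp add: NCW_def)
    \<comment> \<open>The letters of \<open>y\<close> together with 1 leave no gap below
      \<open>top_letter y\<close>, so a letter that is not above it must be among them.\<close>
    ultimately have "c \<in> insert 1 (set y)" using rgf_insert_1[OF y] by auto
    then have cy: "c \<in> set y" "c \<noteq> 1" using v c by auto
    obtain k where k: "set y = {1..k}" using rgf_set[OF y] by blast
    \<comment> \<open>The growth condition for the prefix of length 1 forces the first letter to be
      1.\<close>
    obtain l where l: "set (take 1 y) = {1..l}"
      using y unfolding rgf_def by (meson take_is_prefix)
    have "y \<noteq> []" using cy by auto
    then have "set (take 1 y) = {hd y}" by (cases y) auto
    moreover from this have "card {1..l} = card {hd y}" using l by simp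
    ultimately have "hd y = 1" using l by simp
    then obtain y' where y': "y = 1 # y'" using \<open>y \<noteq> []\<close> by (cases y) auto
    then have "subseq [c] y'" "subseq [c] v" using cy c by (auto simp: subseq_singleton_left)
    then have "subseq ([1] @ [c] @ [1] @ [c]) ([1] @ y' @ [1] @ v)"
      by (intro list_emb_append_mono) auto
    moreover have "1 < c" using \<open>1 \<le> c\<close> cy by simp
    then have "\<not> subseq [1, c, 1, c] (y @ 1 # v)" using nc unfolding noncrossing_def by blast
    ultimately show False using y' by simp
  qed
  define u where "u = map (\<lambda>c. c - top_letter y) v"
  have v_eq: "v = map (\<lambda>c. c + top_letter y) u"
    unfolding u_def map_map by (rule map_idI[symmetric]) (use gt less_imp_le in force)
  have "0 \<notin> set u" using gt by (force simp: u_def)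
  then have "rgf u" using w rgf_append_shift[OF y, of u] by (simp add: NCW_def v_eq)
  moreover have "noncrossing v"
    by (intro noncrossing_subseq[OF nc] subseq_drop_many list_emb_Cons) simp
  then have "noncrossing u" by (simp add: v_eq noncrossing_shift)
  ultimately show ?thesis using yN v_eq by (auto simp: NCW_def)
qed

section \<open>The bijection between sequences of words and words\<close>

lemma assemble_NCW: "set us \<subseteq> NCW \<Longrightarrow> assemble us \<in> NCW"
proof (induction us)
  case Nil
  show ?case by (simp add: Nil_in_NCW)
next
  case (Cons u us)
  then show ?case using NCW_append_shift[of "assemble us" u] by simp
qed

text \<open>On both sides the displayed \<open>c\<close> is the last one in the word, which fixes
  its position.\<close>

lemma append_Cons_last_eq:
  assumes "y @ c # v = y' @ c # v'" "c \<notin> set v" "c \<notin> set v'"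
  shows "y = y' \<and> v = v'"
  using assms by (auto simp: append_eq_append_conv2 append_eq_Cons_conv Cons_eq_append_conv)

lemma shift_no_1: "0 \<notin> set u \<Longrightarrow> 1 \<notin> set (map (\<lambda>c. c + top_letter w) u)"
  using shift_gt[of u 1 w 1] by auto

text \<open>The last 1 of the word separates the final segment from the rest, and the rest
  determines the shift. Repeating this on the shorter word recovers the list, which gives
  injectivity and surjectivity alike.\<close>

lemma bij_betw_assemble: "bij_betw assemble (lists NCW) NCW"
  unfolding bij_betw_def
proof (intro conjI equalityI subsetI)
  show "inj_on assemble (lists NCW)"
  proof (rule inj_onI)
    fix us vs
    show "us \<in> lists NCW \<Longrightarrow> vs \<in> lists NCW \<Longrightarrow> assemble us = assemble vs \<Longrightarrow> us = vs"
    proof (induction us arbitrary: vs)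
      case Nil
      then show ?case by (cases vs) auto
    next
      case (Cons u us)
      then obtain v vs' where vs: "vs = v # vs'" by (cases vs) auto
      define f where "f u us = map (\<lambda>c. c + top_letter (assemble us)) u" for u us
      have "assemble us @ 1 # f u us = assemble vs' @ 1 # f v vs'"
        using Cons.prems(3) by (simp add: vs f_def)
      moreover have "1 \<notin> set (f u us)" "1 \<notin> set (f v vs')"
        using shift_no_1[OF NCW_0] Cons.prems(1,2) unfolding f_def vs by simp_all
      ultimately have "assemble us = assemble vs' \<and> f u us = f v vs'"
        by (rule append_Cons_last_eq)
      then have "us = vs'" "f u us = f v vs'" using Cons.IH[of vs'] Cons.prems(1,2) vs by simp_all
      moreover from this have "u = v" by (simp add: f_def inj_map_eq_map inj_def)
      ultimately show ?case using vs by blast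
    qed
  qed
  fix w
  show "w \<in> assemble ` lists NCW \<Longrightarrow> w \<in> NCW" using assemble_NCW by (auto simp: lists_eq_set)
  show "w \<in> NCW \<Longrightarrow> w \<in> assemble ` lists NCW"
  proof (induction "length w" arbitrary: w rule: less_induct)
    case less
    show ?case
    proof (cases "w = []")
      case True
      then show ?thesis by (auto intro!: image_eqI[of _ _ "[]"])
    next
      case False
      obtain k where k: "set w = {1..k}" using less.prems rgf_set by (auto simp: NCW_def)
      then have "1 \<in> set w" using False by (cases k) auto
      then obtain y v where yv: "w = y @ 1 # v" "1 \<notin> set v" by (meson split_list_last)
      then obtain u where u: "y \<in> NCW" "u \<in> NCW" "v = map (\<lambda>c. c + top_letter y) u"
        using NCW_split_last_1 less.prems by blast
      then obtain us where "us \<in> lists NCW" "y = assemble us"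
        using less.hyps[of y] yv(1) by auto
      then show ?thesis using u yv(1) by (intro image_eqI[of _ _ "u # us"]) auto
    qed
  qed
qed

subsection \<open>Occurrences of the pattern\<close>

lemma order_isomorphic_alt:
  "order_isomorphic u v \<longleftrightarrow> length u = length v \<and>
     (\<forall>i < length u. \<forall>j < length u. u ! i < u ! j \<longleftrightarrow> v ! i < v ! j)"
proof
  assume R: "length u = length v \<and>
     (\<forall>i < length u. \<forall>j < length u. u ! i < u ! j \<longleftrightarrow> v ! i < v ! j)"
  have "u ! i = u ! j \<longleftrightarrow> v ! i = v ! j" if "i < length u" "j < length u" for i j
    using R that by (metis linorder_neqE_nat less_irrefl_nat)
  then show "order_isomorphic u v" using R by (simp add: order_isomorphic_def)
qed (simp add: order_isomorphic_def)

lemma order_isomorphic_shift: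
  "order_isomorphic (map (\<lambda>c. c + d) u) v \<longleftrightarrow> order_isomorphic u v"
  by (auto simp: order_isomorphic_alt)

lemma rgf_order_isomorphic_eq:
  "rgf u \<Longrightarrow> rgf v \<Longrightarrow> order_isomorphic u v \<Longrightarrow> u = v"
proof (induction u arbitrary: v rule: rev_induct)
  case Nil
  then show ?case by (simp add: order_isomorphic_def)
next
  case (snoc c u)
  have len: "length v = Suc (length u)" using snoc.prems(3) by (simp add: order_isomorphic_def)
  then obtain w d where v: "v = w @ [d]" by (cases v rule: rev_cases) auto
  have lw: "length w = length u" using len v by simp
  have iso: "(u @ [c]) ! i = (u @ [c]) ! j \<longleftrightarrow> (w @ [d]) ! i = (w @ [d]) ! j"
    "(u @ [c]) ! i < (u @ [c]) ! j \<longleftrightarrow> (w @ [d]) ! i < (w @ [d]) ! j"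
    if "i < Suc (length u)" "j < Suc (length u)" for i j
    using snoc.prems(3) that unfolding v order_isomorphic_def by auto
  have "order_isomorphic u w"
    unfolding order_isomorphic_alt
  proof (intro conjI allI impI)
    show "length u = length w" by (simp add: lw)
    fix i j assume "i < length u" "j < length u"
    then show "u ! i < u ! j \<longleftrightarrow> w ! i < w ! j"
      using iso(2)[of i j] lw by (simp add: nth_append)
  qed
  then have uw: "u = w" using snoc by (auto simp: rgf_snoc v)
  have "c = u ! i \<longleftrightarrow> d = u ! i" if "i < length u" for i
    using iso(1)[of "length u" i] that uw by (simp add: nth_append)
  then have mem: "x \<in> set u \<Longrightarrow> c = x \<longleftrightarrow> d = x" for x by (metis in_set_conv_nth)
  obtain k l where k: "insert c (set u) = {1..k}" and l: "insert d (set u) = {1..l}"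
    using snoc.prems(1,2) v uw by (auto simp: rgf_snoc)
  have "c = d"
  proof (cases "c \<in> set u")
    case True
    then show ?thesis using mem by blast
  next
    case False
    then have d: "d \<notin> set u" using mem by blast
    \<comment> \<open>Both letters are new, so the two initial intervals have equally many elements
      and coincide.\<close>
    have "card (insert c (set u)) = card (insert d (set u))" using False d by simp
    then have "k = l" unfolding k l by simp
    then have "insert c (set u) = insert d (set u)" using k l by simp
    then show ?thesis using False d by blast
  qed
  then show ?case by (simp add: v uw)
qed

text \<open>A window lies in the left part, in the right part, or consists of a nonempty suffix of
  \<open>y\<close> and a nonempty prefix of \<open>v\<close>; \<open>straddle\<close> rules out the
  last case.\<close>

lemma occurrences_append:
  assumes "\<tau> \<noteq> []"
    and straddle: "\<And>p q. p \<noteq> [] \<Longrightarrow> q \<noteq> [] \<Longrightarrow> suffix p y \<Longrightarrow> prefix q v \<Longrightarrow> \<not> order_isomorphic (p @ q) \<tau>"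
  shows "occurrences \<tau> (y @ v) = occurrences \<tau> y + occurrences \<tau> v"
proof -
  define occ where "occ w = {i. i + length \<tau> \<le> length w \<and> order_isomorphic (take (length \<tau>) (drop i w)) \<tau>}" for w
  have fin: "finite (occ w)" for w
    by (rule finite_subset[of _ "{..length w}"]) (auto simp: occ_def)
  have "occ (y @ v) = occ y \<union> (\<lambda>i. i + length y) ` occ v"
  proof (intro equalityI subsetI)
    fix i assume i: "i \<in> occ (y @ v)"
    consider "i + length \<tau> \<le> length y" | "length y \<le> i" | "i < length y" "length y < i + length \<tau>"
      by linarith
    then show "i \<in> occ y \<union> (\<lambda>i. i + length y) ` occ v"
    proof cases
      case 1
      then show ?thesis using i by (auto simp: occ_def)
    next
      case 2
      then have "i - length y \<in> occ v" using i by (auto simp: occ_def)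
      then show ?thesis using 2 by (auto intro!: image_eqI[of _ _ "i - length y"])
    next
      case 3
      then have "\<not> order_isomorphic (drop i y @ take (length \<tau> - (length y - i)) v) \<tau>"
        using i by (intro straddle) (auto simp: occ_def suffix_drop take_is_prefix)
      then show ?thesis using i 3 by (auto simp: occ_def)
    qed
  next
    fix i assume "i \<in> occ y \<union> (\<lambda>i. i + length y) ` occ v"
    then show "i \<in> occ (y @ v)" by (auto simp: occ_def)
  qed
  moreover have "occ y \<inter> (\<lambda>i. i + length y) ` occ v = {}"
    using assms(1) by (auto simp: occ_def)
  ultimately have "card (occ (y @ v)) = card (occ y) + card (occ v)"
    using fin by (simp add: card_Un_disjoint card_image)
  then show ?thesis by (simp add: occurrences_def occ_def)
qed

text \<open>The only window that is new ends at the added letter, so at most one occurrence is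
  gained.\<close>

lemma occurrences_snoc:
  assumes "\<tau> \<noteq> []"
  shows "occurrences \<tau> (w @ [c]) =
    occurrences \<tau> w + of_bool (\<exists>z. suffix z (w @ [c]) \<and> order_isomorphic z \<tau>)"
proof -
  \<comment> \<open>\<open>k\<close> is the start of that last window. The subtraction truncates
    when the word is too short, so \<open>I\<close> tests the length separately.\<close>
  define n k where "n = length w" and "k = Suc n - length \<tau>"
  define I where "I = {i. i = k \<and> length \<tau> \<le> Suc n \<and> order_isomorphic (drop k (w @ [c])) \<tau>}"
  have "{i. i + length \<tau> \<le> length (w @ [c]) \<and> order_isomorphic (take (length \<tau>) (drop i (w @ [c]))) \<tau>}
     = {i. i + length \<tau> \<le> length w \<and> order_isomorphic (take (length \<tau>) (drop i w)) \<tau>} \<union> I"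
    (is "?A = ?B \<union> I")
  proof (intro set_eqI)
    fix i
    consider "i + length \<tau> \<le> n" | "i + length \<tau> = Suc n" | "i + length \<tau> > Suc n" by linarith
    then show "i \<in> ?A \<longleftrightarrow> i \<in> ?B \<union> I"
    proof cases
      case 2
      then have "i = k" "take (length \<tau>) (drop i (w @ [c])) = drop i (w @ [c])"
        by (simp_all add: k_def n_def)
      then show ?thesis using 2 by (simp add: I_def n_def del: drop_append take_append)
    qed (auto simp: I_def k_def n_def)
  qed
  moreover have "?B \<inter> I = {}" by (auto simp: I_def k_def n_def)
  moreover have "finite ?B" by (rule finite_subset[of _ "{..length w}"]) auto
  moreover have "finite I" by (auto simp: I_def)
  ultimately have "occurrences \<tau> (w @ [c]) = occurrences \<tau> w + card I"
    by (simp add: occurrences_def card_Un_disjoint)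
  moreover have "(\<exists>z. suffix z (w @ [c]) \<and> order_isomorphic z \<tau>) \<longleftrightarrow>
    length \<tau> \<le> Suc n \<and> order_isomorphic (drop k (w @ [c])) \<tau>"
  proof
    assume "\<exists>z. suffix z (w @ [c]) \<and> order_isomorphic z \<tau>"
    then obtain z where z: "suffix z (w @ [c])" "order_isomorphic z \<tau>" by blast
    then have lz: "length z = length \<tau>" by (simp add: order_isomorphic_def)
    obtain p where p: "w @ [c] = p @ z" using z(1) by (auto simp: suffix_def)
    have "Suc n = length p + length z" using arg_cong[OF p, of length] by (simp add: n_def)
    then have "length \<tau> \<le> Suc n" "length p = k" by (simp_all add: k_def lz)
    then show "length \<tau> \<le> Suc n \<and> order_isomorphic (drop k (w @ [c])) \<tau>"
      using z(2) unfolding p by simp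
  qed (use suffix_drop in blast)
  moreover have "I = (if length \<tau> \<le> Suc n \<and> order_isomorphic (drop k (w @ [c])) \<tau> then {k} else {})"
    by (auto simp: I_def)
  ultimately show ?thesis by simp
qed

lemma occurrences_shift: "occurrences \<tau> (map (\<lambda>c. c + d) u) = occurrences \<tau> u"
  by (simp add: occurrences_def drop_map take_map order_isomorphic_shift)

text \<open>The entries of \<rho> are positive, so the shifted copy lies strictly above 1. The ones
  of the pattern thus correspond to a single letter \<open>c\<close> below everything in the
  middle.\<close>

lemma order_isomorphic_pattern:
  assumes "a \<ge> 1" "b \<ge> 1" "0 \<notin> set \<rho>"
  shows "order_isomorphic z (replicate a 1 @ map (\<lambda>c. c + 1) \<rho> @ replicate b 1) \<longleftrightarrow>
    (\<exists>c r. z = replicate a c @ r @ replicate b c \<and> (\<forall>x\<in>set r. c < x) \<and> order_isomorphic r \<rho>)"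
    (is "order_isomorphic z ?\<tau> \<longleftrightarrow> ?R")
proof
  assume iso: "order_isomorphic z ?\<tau>"
  define m where "m = length \<rho>"
  have len: "length z = a + m + b" using iso by (simp add: order_isomorphic_def m_def)
  have less: "z ! i < z ! j \<longleftrightarrow> ?\<tau> ! i < ?\<tau> ! j" and eq: "z ! i = z ! j \<longleftrightarrow> ?\<tau> ! i = ?\<tau> ! j"
    if "i < a + m + b" "j < a + m + b" for i j
    using iso that unfolding order_isomorphic_def len by blast+
  have \<tau>: "?\<tau> ! i = (if a \<le> i \<and> i < a + m then \<rho> ! (i - a) + 1 else 1)" if "i < a + m + b" for i
    using that by (auto simp: nth_append m_def)
  define c r where "c = z ! 0" and "r = take m (drop a z)"
  have c: "z ! i = c" if "i < a + m + b" "\<not> (a \<le> i \<and> i < a + m)" for i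
    using eq[of i 0] \<tau>[of i] \<tau>[of 0] that assms(1) by (auto simp: c_def)
  have r: "z ! (a + i) = r ! i" "length r = m" if "i < m" for i
    using that by (auto simp: r_def len)
  have lr: "length r = m" by (simp add: r_def len)
  have "z = replicate a c @ r @ replicate b c"
  proof (rule nth_equalityI)
    show "length z = length (replicate a c @ r @ replicate b c)" by (simp add: len lr)
    fix i assume "i < length z"
    then show "z ! i = (replicate a c @ r @ replicate b c) ! i"
      using c[of i] r(1)[of "i - a"] by (auto simp: nth_append lr len)
  qed
  moreover have "c < r ! i" if "i < m" for i
  proof -
    have "\<rho> ! i \<noteq> 0" using assms(3) that by (metis nth_mem m_def)
    then show ?thesis
      using less[of 0 "a + i"] \<tau>[of 0] \<tau>[of "a + i"] r(1)[of i] that assms by (simp add: c_def)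
  qed
  then have "\<forall>x\<in>set r. c < x" by (auto simp: in_set_conv_nth lr)
  moreover have "order_isomorphic r \<rho>"
    unfolding order_isomorphic_alt
  proof (intro conjI allI impI)
    show "length r = length \<rho>" by (simp add: lr m_def)
    fix i j assume "i < length r" "j < length r"
    then show "r ! i < r ! j \<longleftrightarrow> \<rho> ! i < \<rho> ! j"
      using less[of "a + i" "a + j"] \<tau>[of "a + i"] \<tau>[of "a + j"] r(1)[of i] r(1)[of j] lr by simp
  qed
  ultimately show ?R by blast
next
  assume ?R
  then obtain c r where z: "z = replicate a c @ r @ replicate b c" "\<forall>x\<in>set r. c < x" "order_isomorphic r \<rho>"
    by blast
  have lr: "length r = length \<rho>" using z(3) by (simp add: order_isomorphic_def)
  have r: "c < r ! i" if "i < length \<rho>" for i using z(2) that lr by simp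
  have \<rho>: "0 < \<rho> ! i" if "i < length \<rho>" for i using assms(3) that by (metis gr0I nth_mem)
  have rr: "r ! i < r ! j \<longleftrightarrow> \<rho> ! i < \<rho> ! j" if "i < length \<rho>" "j < length \<rho>" for i j
    using z(3) that lr by (simp add: order_isomorphic_def)
  have zn: "z ! i = (if a \<le> i \<and> i < a + length \<rho> then r ! (i - a) else c)" if "i < a + length \<rho> + b" for i
    using that by (auto simp: nth_append z(1) lr)
  have \<tau>: "?\<tau> ! i = (if a \<le> i \<and> i < a + length \<rho> then \<rho> ! (i - a) + 1 else 1)" if "i < a + length \<rho> + b" for i
    using that by (auto simp: nth_append)
  have r': "c < r ! (i - a)" and \<rho>': "0 < \<rho> ! (i - a)" if "a \<le> i" "i < a + length \<rho>" for i
    using r[of "i - a"] \<rho>[of "i - a"] that by simp_all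
  have rr': "r ! (i - a) < r ! (j - a) \<longleftrightarrow> \<rho> ! (i - a) < \<rho> ! (j - a)"
    if "a \<le> i" "i < a + length \<rho>" "a \<le> j" "j < a + length \<rho>" for i j
    using rr[of "i - a" "j - a"] that by simp
  show "order_isomorphic z ?\<tau>"
    unfolding order_isomorphic_alt
  proof (intro conjI allI impI)
    show "length z = length ?\<tau>" by (simp add: z(1) lr)
    fix i j assume "i < length z" "j < length z"
    then have i: "i < a + length \<rho> + b" and j: "j < a + length \<rho> + b"
      by (simp_all add: z(1) lr)
    show "z ! i < z ! j \<longleftrightarrow> ?\<tau> ! i < ?\<tau> ! j"
      unfolding \<tau>[OF i] \<tau>[OF j] zn[OF i] zn[OF j]
      using rr'[of i j] r'[of i] r'[of j] \<rho>'[of i] \<rho>'[of j] by auto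
  qed
qed

section \<open>Suffixes of an assembled word followed by a 1\<close>

lemma suffix_snoc_snoc: "suffix (xs @ [x]) (ys @ [y]) \<longleftrightarrow> x = y \<and> suffix xs ys"
  by (auto simp: suffix_def)

lemma replicate_Suc_snoc: "replicate (Suc n) x = replicate n x @ [x]"
  by (simp add: replicate_append_same)

text \<open>Two final ones mean that \<open>assemble us\<close> itself ends in 1. This 1 opens the
  last segment, which is then empty; removing that segment leaves its 1 in the role of the appended
  one.\<close>

lemma suffix_assemble_peel:
  assumes "us \<in> lists NCW"
  shows "suffix (z @ [1, 1]) (assemble us @ [1]) \<longleftrightarrow>
    (\<exists>vs. us = [] # vs \<and> suffix (z @ [1]) (assemble vs @ [1]))"
proof (cases us)
  case Nil
  then show ?thesis by (auto simp: suffix_def Cons_eq_append_conv append_eq_Cons_conv)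
next
  case (Cons u vs)
  have eq: "suffix (z @ [1, 1]) (assemble us @ [1]) \<longleftrightarrow> suffix (z @ [1]) (assemble us)"
    using suffix_snoc_snoc[of "z @ [1]" 1 "assemble us" 1] by simp
  show ?thesis
  proof (cases "u = []")
    case True
    then show ?thesis unfolding eq using Cons by simp
  next
    case False
    define v where "v = map (\<lambda>c. c + top_letter (assemble vs)) u"
    have "1 \<notin> set v" using shift_no_1[OF NCW_0] assms Cons by (simp add: v_def)
    moreover obtain v' x where v': "v = v' @ [x]" using False by (cases v rule: rev_cases) (auto simp: v_def)
    ultimately have "x \<noteq> 1" by auto
    moreover have "assemble us = (assemble vs @ 1 # v') @ [x]" using v' by (simp add: Cons v_def)
    ultimately have "\<not> suffix (z @ [1]) (assemble us)" by (simp only: suffix_snoc_snoc) simp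
    then show ?thesis unfolding eq using Cons False by simp
  qed
qed

lemma suffix_assemble_ones:
  assumes "us \<in> lists NCW"
  shows "suffix (replicate (Suc n) 1) (assemble us @ [1]) \<longleftrightarrow> prefix (replicate n []) us"
  using assms
proof (induction n arbitrary: us)
  case 0
  then show ?case by (simp add: suffix_def)
next
  case (Suc n)
  have "replicate (Suc (Suc n)) (1 :: nat) = replicate n 1 @ [1, 1]"
    "replicate (Suc n) (1 :: nat) = replicate n 1 @ [1]"
    by (simp_all add: replicate_Suc_snoc del: replicate_Suc)
  then have "suffix (replicate (Suc (Suc n)) 1) (assemble us @ [1]) \<longleftrightarrow>
    (\<exists>vs. us = [] # vs \<and> suffix (replicate (Suc n) 1) (assemble vs @ [1]))"
    using suffix_assemble_peel[OF Suc.prems, of "replicate n 1"] by (simp only:)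
  also have "\<dots> \<longleftrightarrow> (\<exists>vs. us = [] # vs \<and> prefix (replicate n []) vs)"
    by (intro ex_cong1 conj_cong refl Suc.IH) (use Suc.prems in simp)
  also have "\<dots> \<longleftrightarrow> prefix (replicate (Suc n) []) us"
    by (cases us) auto
  finally show ?case .
qed

text \<open>As \<open>r\<close> contains no 1, it must be the whole last segment. Of the
  \<open>Suc n\<close> ones before it, one opens this segment and the others open \<open>n\<close>
  empty segments.\<close>

lemma suffix_assemble_middle:
  assumes "us \<in> lists NCW" "1 \<notin> set r" "r \<noteq> []"
  shows "suffix (replicate (Suc n) 1 @ r @ [1]) (assemble us @ [1]) \<longleftrightarrow>
    (\<exists>u vs. us = u # vs \<and> r = map (\<lambda>c. c + top_letter (assemble vs)) u \<and> prefix (replicate n []) vs)"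
proof -
  have eq: "suffix (replicate (Suc n) 1 @ r @ [1]) (assemble us @ [1]) \<longleftrightarrow>
    suffix (replicate (Suc n) 1 @ r) (assemble us)"
    using suffix_snoc_snoc[of "replicate (Suc n) 1 @ r" 1 "assemble us" 1] by simp
  have sn: "replicate (Suc n) (1 :: nat) @ r = replicate n 1 @ 1 # r"
    by (simp add: replicate_app_Cons_same)
  show ?thesis
  proof (cases us)
    case Nil
    then show ?thesis unfolding eq by simp
  next
    case (Cons u vs)
    define v where "v = map (\<lambda>c. c + top_letter (assemble vs)) u"
    have v: "1 \<notin> set v" using shift_no_1[OF NCW_0] assms(1) Cons by (simp add: v_def)
    have "suffix (replicate (Suc n) 1 @ r) (assemble us) \<longleftrightarrow>
       r = v \<and> suffix (replicate (Suc n) 1) (assemble vs @ [1])"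
    proof
      assume "suffix (replicate (Suc n) 1 @ r) (assemble us)"
      then obtain p where "(p @ replicate n 1) @ 1 # r = assemble vs @ 1 # v"
        unfolding suffix_def sn by (auto simp: Cons v_def)
      then have "p @ replicate n 1 = assemble vs \<and> r = v"
        by (rule append_Cons_last_eq) (use v assms in auto)
      moreover from this have "assemble vs @ [1] = p @ replicate (Suc n) 1"
        by (metis append_assoc replicate_Suc_snoc)
      ultimately show "r = v \<and> suffix (replicate (Suc n) 1) (assemble vs @ [1])"
        by (auto simp: suffix_def)
    next
      assume R: "r = v \<and> suffix (replicate (Suc n) 1) (assemble vs @ [1])"
      have "assemble us = (assemble vs @ [1]) @ v" by (simp add: Cons v_def)
      then show "suffix (replicate (Suc n) 1 @ r) (assemble us)"
        using R by (auto simp: suffix_def)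
    qed
    then show ?thesis
      unfolding eq using suffix_assemble_ones[of vs n] assms(1) Cons by (auto simp: v_def)
  qed
qed

text \<open>Peeling off the \<open>n\<close> surplus ones on the right, each opening an empty
  segment, reduces this to \<open>suffix_assemble_middle\<close>.\<close>

lemma suffix_assemble_pattern:
  assumes "us \<in> lists NCW" "1 \<notin> set r" "r \<noteq> []"
  shows "suffix (replicate (Suc k) 1 @ r @ replicate (Suc n) 1) (assemble us @ [1]) \<longleftrightarrow>
    (\<exists>u vs. us = replicate n [] @ u # vs \<and> r = map (\<lambda>c. c + top_letter (assemble vs)) u
       \<and> prefix (replicate k []) vs)"
  using assms(1)
proof (induction n arbitrary: us)
  case 0
  then show ?case using suffix_assemble_middle[OF _ assms(2,3), of us k] by simp
next
  case (Suc n)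
  have "replicate (Suc (Suc n)) (1 :: nat) = replicate n 1 @ [1, 1]"
    "replicate (Suc n) (1 :: nat) = replicate n 1 @ [1]"
    by (simp_all add: replicate_Suc_snoc del: replicate_Suc)
  then have "suffix (replicate (Suc k) 1 @ r @ replicate (Suc (Suc n)) 1) (assemble us @ [1]) \<longleftrightarrow>
    (\<exists>vs. us = [] # vs \<and> suffix (replicate (Suc k) 1 @ r @ replicate (Suc n) 1) (assemble vs @ [1]))"
    using suffix_assemble_peel[OF Suc.prems, of "replicate (Suc k) 1 @ r @ replicate n 1"]
    by (simp only: append_assoc)
  also have "\<dots> \<longleftrightarrow> (\<exists>ws. us = [] # ws \<and> (\<exists>u vs. ws = replicate n [] @ u # vs
     \<and> r = map (\<lambda>c. c + top_letter (assemble vs)) u \<and> prefix (replicate k []) vs))"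
    using Suc by (intro ex_cong1 conj_cong refl) auto
  also have "\<dots> \<longleftrightarrow> (\<exists>u vs. us = replicate (Suc n) [] @ u # vs
     \<and> r = map (\<lambda>c. c + top_letter (assemble vs)) u \<and> prefix (replicate k []) vs)"
    by auto
  finally show ?case .
qed

section \<open>Occurrences as factors of the sequence of segments\<close>

locale subword_pattern =
  fixes a b :: nat and \<rho> :: "nat list"
  assumes a: "a \<ge> 1" and b: "b \<ge> 1" and \<rho>: "\<rho> \<in> NCW" "\<rho> \<noteq> []"
begin

definition \<tau> :: "nat list" where
  "\<tau> = replicate a 1 @ map (\<lambda>c. c + 1) \<rho> @ replicate b 1"

text \<open>The exponents appear swapped because \<open>assemble\<close> lists the segments from right to left.\<close>

definition block_pattern :: "nat list list" where
  "block_pattern = replicate (b - 1) [] @ \<rho> # replicate (a - 1) []"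

lemma \<tau>_Nil: "\<tau> \<noteq> []"
  using \<rho> by (simp add: \<tau>_def)

lemmas iso_\<tau> = order_isomorphic_pattern[OF a b NCW_0[OF \<rho>(1)], folded \<tau>_def]

text \<open>The occurrence ends in the appended 1, so its least letter is 1 and its middle is a full
  segment. The unshifted segment is order-isomorphic to \<rho>, and equals it because both are
  restricted growth functions.\<close>

lemma suffix_iso_iff:
  assumes "us \<in> lists NCW"
  shows "(\<exists>z. suffix z (assemble us @ [1]) \<and> order_isomorphic z \<tau>) \<longleftrightarrow> prefix block_pattern us"
proof -
  obtain k n where kn: "a = Suc k" "b = Suc n" using a b by (cases a; cases b) auto
  have bp: "block_pattern = replicate n [] @ \<rho> # replicate k []"
    unfolding block_pattern_def by (simp add: kn)
  show ?thesis
  proof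
    assume "\<exists>z. suffix z (assemble us @ [1]) \<and> order_isomorphic z \<tau>"
    then obtain c r where r: "suffix (replicate a c @ r @ replicate b c) (assemble us @ [1])"
      "\<forall>x\<in>set r. c < x" "order_isomorphic r \<rho>"
      unfolding iso_\<tau> by blast
    have "replicate a c @ r @ replicate b c = (replicate a c @ r @ replicate n c) @ [c]"
      by (simp add: kn replicate_append_same)
    then have c: "c = 1" using r(1) by (simp only: suffix_snoc_snoc)
    have "r \<noteq> []" using r(3) \<rho>(2) by (auto simp: order_isomorphic_def)
    then obtain u vs where u: "us = replicate n [] @ u # vs"
      "r = map (\<lambda>c. c + top_letter (assemble vs)) u" "prefix (replicate k []) vs"
      using r suffix_assemble_pattern[OF assms, of r k n] unfolding c kn by blast
    have "order_isomorphic u \<rho>" using r(3) unfolding u(2) order_isomorphic_shift .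
    moreover have "u \<in> NCW" using assms u(1) by simp
    ultimately have "u = \<rho>" using \<rho>(1) rgf_order_isomorphic_eq by (simp add: NCW_def)
    then show "prefix block_pattern us" using u \<open>u = \<rho>\<close> unfolding bp by auto
  next
    assume "prefix block_pattern us"
    then obtain vs where vs: "us = replicate n [] @ \<rho> # vs" "prefix (replicate k []) vs"
      unfolding bp by (auto simp: prefix_def)
    define r where "r = map (\<lambda>c. c + top_letter (assemble vs)) \<rho>"
    have "r \<noteq> []" "1 \<notin> set r" "\<forall>x\<in>set r. 1 < x" "order_isomorphic r \<rho>"
      using \<rho> shift_no_1[OF NCW_0[OF \<rho>(1)]] shift_gt[OF NCW_0[OF \<rho>(1)], of 1 "assemble vs"]
      unfolding r_def order_isomorphic_shift by (auto simp: order_isomorphic_def)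
    then show "\<exists>z. suffix z (assemble us @ [1]) \<and> order_isomorphic z \<tau>"
      using suffix_assemble_pattern[OF assms, of r k n] vs unfolding iso_\<tau> unfolding kn r_def by blast
  qed
qed

text \<open>An occurrence across the boundary would contain the separating 1, while its last letter,
  which is its least, would lie in the shifted segment and exceed 1.\<close>

lemma occurrences_append_shift:
  assumes "us \<in> lists NCW" "u \<in> NCW"
  shows "occurrences \<tau> (assemble (u # us)) = occurrences \<tau> (assemble us @ [1]) + occurrences \<tau> u"
proof -
  define v where "v = map (\<lambda>c. c + top_letter (assemble us)) u"
  have "occurrences \<tau> ((assemble us @ [1]) @ v) = occurrences \<tau> (assemble us @ [1]) + occurrences \<tau> v"
  proof (rule occurrences_append[OF \<tau>_Nil])
    fix p q assume pq: "p \<noteq> []" "q \<noteq> []" "suffix p (assemble us @ [1])" "prefix q v"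
    show "\<not> order_isomorphic (p @ q) \<tau>"
    proof
      assume "order_isomorphic (p @ q) \<tau>"
      then obtain c r where cr: "p @ q = replicate a c @ r @ replicate b c" "\<forall>x\<in>set r. c < x"
        unfolding iso_\<tau> by blast
      have "last (p @ q) = c" unfolding cr using b by simp
      then have "c \<in> set v" using pq(2,4) last_in_set[of q] by (auto simp: prefix_def)
      then have "1 < c" using shift_gt[OF NCW_0[OF assms(2)], of 1 "assemble us" c] by (simp add: v_def)
      moreover have "1 \<in> set (p @ q)"
        using pq(1,3) by (cases p rule: rev_cases) (auto simp: suffix_snoc_snoc)
      then have "c \<le> 1" unfolding cr using cr(2) by auto
      ultimately show False by simp
    qed
  qed
  then show ?thesis by (simp add: v_def occurrences_shift)
qed

end

subsection \<open>The functional equations\<close>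

lemma NC_subset_NCW: "NC n \<subseteq> NCW" and length_NC: "w \<in> NC n \<Longrightarrow> length w = n"
  and NCW_imp_NC: "w \<in> NCW \<Longrightarrow> w \<in> NC (length w)"
  by (auto simp: NC_iff NCW_def)

text \<open>The successor accounts for the 1 that opens each segment.\<close>

definition list_size :: "nat list list \<Rightarrow> nat" where
  "list_size us = (\<Sum>u\<leftarrow>us. Suc (length u))"

lemma finite_list_size: "finite {us \<in> lists NCW. list_size us = n}"
proof (rule finite_subset)
  have "length us \<le> list_size us" "u \<in> set us \<Longrightarrow> length u \<le> list_size us" for us and u :: "nat list"
    by (induction us) (auto simp: list_size_def)
  then show "{us \<in> lists NCW. list_size us = n} \<subseteq> {us. set us \<subseteq> (\<Union>k\<le>n. NC k) \<and> length us \<le> n}"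
    using NCW_imp_NC by fastforce
  show "finite {us. set us \<subseteq> (\<Union>k\<le>n. NC k) \<and> length us \<le> n}"
    by (rule finite_lists_length_le) (simp add: finite_NC)
qed

lemma length_assemble: "length (assemble us) = list_size us"
  by (induction us) (auto simp: list_size_def)

section \<open>Weights of words and sequences, and their generating functions\<close>

context subword_pattern
begin

abbreviation q :: "rat poly fract fps" where
  "q \<equiv> fps_const qvar"

definition weight :: "nat list \<Rightarrow> rat poly fract fps" where
  "weight w = fps_const (qvar ^ occurrences \<tau> w) * fps_X ^ length w"

text \<open>The appended 1 stands for the term that follows the sequence.\<close>

definition seq_weight :: "nat list list \<Rightarrow> rat poly fract fps" where
  "seq_weight us = fps_const (qvar ^ occurrences \<tau> (assemble us @ [1])) * fps_X ^ list_size us"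

lemma weight_nth: "weight w $ n = (if n = length w then qvar ^ occurrences \<tau> w else 0)"
  by (simp add: weight_def fps_X_power_nth)

lemma seq_weight_nth: "seq_weight us $ n \<noteq> 0 \<Longrightarrow> list_size us = n"
  by (auto simp: seq_weight_def fps_X_power_nth split: if_splits)

lemma NC_gf_eq: "NC_gf \<tau> = fps_infsum weight NCW"
proof (rule fps_ext)
  fix n
  have "fps_infsum weight NCW $ n = (\<Sum>w\<in>NC n. weight w $ n)"
    using NC_subset_NCW NCW_imp_NC
    by (intro fps_infsum_nth) (auto simp: weight_nth finite_NC split: if_splits)
  then show "NC_gf \<tau> $ n = fps_infsum weight NCW $ n"
    by (simp add: NC_gf_def weight_nth length_NC)
qed

lemma locally_finite_weight: "fps_locally_finite weight NCW"
  by (rule fps_locally_finiteI[of NC]) (auto simp: weight_nth finite_NC NCW_imp_NC split: if_splits)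

lemma locally_finite_seq_weight: "fps_locally_finite seq_weight (lists NCW)"
  by (rule fps_locally_finiteI[of "\<lambda>n. {us \<in> lists NCW. list_size us = n}"])
    (auto simp: finite_list_size dest: seq_weight_nth)

lemma locally_finite_weight_assemble: "fps_locally_finite (\<lambda>us. weight (assemble us)) (lists NCW)"
  by (rule fps_locally_finiteI[of "\<lambda>n. {us \<in> lists NCW. list_size us = n}"])
    (auto simp: finite_list_size weight_nth length_assemble split: if_splits)

lemma locally_finite_append:
  assumes "fps_locally_finite f (lists NCW)" "set vs \<subseteq> NCW"
  shows "fps_locally_finite (\<lambda>us. f (vs @ us)) (lists NCW)"
proof (rule fps_locally_finiteI)
  show "finite ((@) vs -` {us \<in> lists NCW. f us $ n \<noteq> 0})" for n
    using assms(1) by (intro finite_vimageI) (auto simp: fps_locally_finite_def inj_def)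
qed (use assms(2) in auto)

lemma weight_Nil: "weight [] = 1"
  using \<tau>_Nil by (simp add: weight_def occurrences_def)

lemma weight_\<rho>: "weight \<rho> = fps_X ^ length \<rho>"
proof -
  have "length \<rho> < length \<tau>" using a by (simp add: \<tau>_def)
  then have "{i. i + length \<tau> \<le> length \<rho> \<and> order_isomorphic (take (length \<tau>) (drop i \<rho>)) \<tau>} = {}"
    by auto
  then have "occurrences \<tau> \<rho> = 0" unfolding occurrences_def by (simp only: card.empty)
  then show ?thesis by (simp add: weight_def)
qed

lemma weight_assemble_Cons:
  assumes "us \<in> lists NCW" "u \<in> NCW"
  shows "weight (assemble (u # us)) = fps_X * weight u * seq_weight us"
  using occurrences_append_shift[OF assms] length_assemble[of us]
  by (simp add: weight_def seq_weight_def power_add mult_ac)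

text \<open>The following 1 completes one more occurrence exactly when the list starts with
  \<open>block_pattern\<close>, and then the weight gains a factor \<open>q\<close>.\<close>

lemma seq_weight_eq:
  assumes "us \<in> lists NCW"
  shows "seq_weight us =
    weight (assemble us) + (q - 1) * (of_bool (prefix block_pattern us) * weight (assemble us))"
proof -
  have "occurrences \<tau> (assemble us @ [1]) =
    occurrences \<tau> (assemble us) + of_bool (prefix block_pattern us)"
    using occurrences_snoc[OF \<tau>_Nil, of "assemble us" 1] unfolding suffix_iso_iff[OF assms] .
  then have "seq_weight us = (if prefix block_pattern us then q else 1) * weight (assemble us)"
    by (simp add: seq_weight_def weight_def length_assemble mult_ac)
  then show ?thesis by (simp add: algebra_simps)
qed

definition F :: "rat poly fract fps" where
  "F = fps_infsum weight NCW"

text \<open>\<open>G 0\<close> is the series of all sequences and \<open>G (a - 1)\<close> is the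
  series written K in the outline. The \<open>k\<close> empty words stand at the end of the
  sequence, that is, at the head of the list.\<close>

definition G :: "nat \<Rightarrow> rat poly fract fps" where
  "G k = fps_infsum (\<lambda>us. seq_weight (replicate k [] @ us)) (lists NCW)"

lemma F_assemble: "F = fps_infsum (\<lambda>us. weight (assemble us)) (lists NCW)"
  unfolding F_def by (rule fps_infsum_reindex[OF bij_betw_assemble])

text \<open>A nonempty list splits into its head, the last segment, and a list weighted as if
  followed by the 1 that opens this segment; that 1 supplies the factor
  \<open>fps_X\<close>.\<close>

lemma F_eq: "F = 1 + fps_X * F * G 0"
proof -
  define C where "C = (\<lambda>(u, us). u # us) ` (NCW \<times> lists NCW)"
  have lists: "lists NCW = {[]} \<union> C"
  proof (rule set_eqI)
    show "us \<in> lists NCW \<longleftrightarrow> us \<in> {[]} \<union> C" for us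
      by (cases us) (auto simp: C_def)
  qed
  have "fps_locally_finite (\<lambda>us. weight (assemble us)) {[]}"
    by (simp add: fps_locally_finite_finite)
  moreover have "fps_locally_finite (\<lambda>us. weight (assemble us)) C"
    using locally_finite_weight_assemble by (rule fps_locally_finite_mono) (auto simp: lists)
  ultimately have "F = 1 + fps_infsum (\<lambda>us. weight (assemble us)) C"
    unfolding F_assemble lists by (subst fps_infsum_Un_disjoint) (auto simp: C_def fps_infsum_finite weight_Nil)
  also have "bij_betw (\<lambda>(u, us). u # us) (NCW \<times> lists NCW) C"
    by (auto simp: C_def bij_betw_def inj_on_def)
  then have "fps_infsum (\<lambda>us. weight (assemble us)) C =
    fps_infsum (\<lambda>p. weight (assemble (case p of (u, us) \<Rightarrow> u # us))) (NCW \<times> lists NCW)"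
    by (rule fps_infsum_reindex)
  also have "\<dots> = fps_infsum (\<lambda>(u, us). (fps_X * weight u) * seq_weight us) (NCW \<times> lists NCW)"
    by (rule fps_infsum_cong) (auto simp only: mem_Times_iff prod.case split_paired_all
      fst_conv snd_conv weight_assemble_Cons)
  also have "\<dots> = fps_X * F * G 0"
    using locally_finite_weight locally_finite_seq_weight
    by (simp add: fps_infsum_times fps_locally_finite_cmult fps_infsum_cmult F_def G_def)
  finally show ?thesis .
qed

text \<open>An occurrence around this segment needs \<open>b\<close> ones after it, and only
  \<open>j\<close> are present, so each appended 1 contributes just its length.\<close>

lemma weight_assemble_no_match:
  assumes "us \<in> lists NCW" "j < b"
  shows "weight (assemble (replicate j [] @ \<rho> # us)) = fps_X ^ (j + length \<rho> + 1) * seq_weight us"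
  using assms(2)
proof (induction j)
  case 0
  then show ?case using weight_assemble_Cons[OF assms(1) \<rho>(1)] by (simp add: weight_\<rho> mult_ac)
next
  case (Suc j)
  have in_lists: "replicate j [] @ \<rho> # us \<in> lists NCW" "[] \<in> NCW"
    using assms(1) \<rho>(1) Nil_in_NCW by auto
  have "\<not> prefix block_pattern (replicate j [] @ \<rho> # us)"
  proof
    assume "prefix block_pattern (replicate j [] @ \<rho> # us)"
    then obtain ws where "replicate j [] @ \<rho> # us = block_pattern @ ws" by (auto simp: prefix_def)
    \<comment> \<open>At index \<open>j\<close> the list has the nonempty \<rho>, while
      \<open>block_pattern\<close> still has an empty word there.\<close>
    then have "(replicate j [] @ \<rho> # us) ! j = (block_pattern @ ws) ! j" by simp
    moreover have "j < b - 1" using Suc.prems by simp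
    ultimately show False using \<rho>(2) by (simp add: block_pattern_def nth_append)
  qed
  then have "seq_weight (replicate j [] @ \<rho> # us) = weight (assemble (replicate j [] @ \<rho> # us))"
    using seq_weight_eq[OF in_lists(1)] by simp
  moreover have "weight (assemble ([] # replicate j [] @ \<rho> # us)) = fps_X * seq_weight (replicate j [] @ \<rho> # us)"
    using weight_assemble_Cons[OF in_lists] by (simp add: weight_Nil)
  ultimately show ?case using Suc by (simp add: mult_ac)
qed

text \<open>For \<open>i < b\<close> the prescribed empty words are part of the pattern, so the
  matching lists are \<open>block_pattern\<close> followed by an arbitrary list, and the sum does
  not depend on \<open>i\<close>. The exponent counts \<rho>, the 1 before it and
  \<open>b - 1\<close> ones after it.\<close>

lemma matching_weight:
  assumes "i < b"
  shows "fps_infsum (\<lambda>us. of_bool (prefix block_pattern (replicate i [] @ us)) *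
      weight (assemble (replicate i [] @ us))) (lists NCW) = fps_X ^ (b + length \<rho>) * G (a - 1)"
proof -
  define tl_pattern where "tl_pattern = replicate (b - 1 - i) [] @ \<rho> # replicate (a - 1) []"
  have "replicate (b - 1) ([] :: nat list) = replicate i [] @ replicate (b - 1 - i) []"
    using assms by (simp flip: replicate_add)
  then have bp: "block_pattern = replicate i [] @ tl_pattern"
    by (simp add: block_pattern_def tl_pattern_def)
  have "fps_infsum (\<lambda>us. of_bool (prefix block_pattern (replicate i [] @ us)) *
      weight (assemble (replicate i [] @ us))) (lists NCW) =
    fps_infsum (\<lambda>us. weight (assemble (replicate i [] @ us))) {us \<in> lists NCW. prefix tl_pattern us}"
    by (simp only: fps_infsum_of_bool bp same_prefix_prefix)
  also have "bij_betw ((@) tl_pattern) (lists NCW) {us \<in> lists NCW. prefix tl_pattern us}"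
    using \<rho>(1) Nil_in_NCW by (auto simp: bij_betw_def inj_on_def prefix_def tl_pattern_def)
  then have "fps_infsum (\<lambda>us. weight (assemble (replicate i [] @ us))) {us \<in> lists NCW. prefix tl_pattern us}
    = fps_infsum (\<lambda>us. weight (assemble (replicate i [] @ tl_pattern @ us))) (lists NCW)"
    by (rule fps_infsum_reindex)
  also have "\<dots> = fps_infsum (\<lambda>us. fps_X ^ (b + length \<rho>) * seq_weight (replicate (a - 1) [] @ us)) (lists NCW)"
  proof (rule fps_infsum_cong)
    fix us assume "us \<in> lists NCW"
    then have "replicate (a - 1) [] @ us \<in> lists NCW" using Nil_in_NCW by auto
    from weight_assemble_no_match[OF this, of "b - 1"] b
    show "weight (assemble (replicate i [] @ tl_pattern @ us)) =
      fps_X ^ (b + length \<rho>) * seq_weight (replicate (a - 1) [] @ us)"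
      unfolding append_assoc[symmetric] bp[symmetric] by (simp add: block_pattern_def)
  qed
  also have "\<dots> = fps_X ^ (b + length \<rho>) * G (a - 1)"
    unfolding G_def using Nil_in_NCW
    by (intro fps_infsum_cmult locally_finite_append locally_finite_seq_weight) auto
  finally show ?thesis .
qed

lemma G_eq:
  "G k = fps_infsum (\<lambda>us. weight (assemble (replicate k [] @ us))) (lists NCW) +
    (q - 1) * (of_bool (k < b) * fps_X ^ (b + length \<rho>) * G (a - 1))"
proof -
  let ?w = "\<lambda>us. weight (assemble (replicate k [] @ us))"
  let ?m = "\<lambda>us. of_bool (prefix block_pattern (replicate k [] @ us)) * ?w us"
  have "G k = fps_infsum (\<lambda>us. ?w us + (q - 1) * ?m us) (lists NCW)"
    unfolding G_def by (intro fps_infsum_cong seq_weight_eq) (use Nil_in_NCW in auto)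
  also have "fps_locally_finite ?w (lists NCW)"
    using Nil_in_NCW by (intro locally_finite_append locally_finite_weight_assemble) auto
  moreover have "fps_locally_finite ?m (lists NCW)"
    by (rule fps_locally_finiteI[OF fps_locally_finite_below[OF calculation(2)]]) (auto simp: of_bool_def)
  ultimately have "G k = fps_infsum ?w (lists NCW) + (q - 1) * fps_infsum ?m (lists NCW)"
    by (simp add: fps_infsum_add fps_infsum_cmult fps_locally_finite_cmult)
  also have "fps_infsum ?m (lists NCW) = of_bool (k < b) * fps_X ^ (b + length \<rho>) * G (a - 1)"
  proof (cases "k < b")
    case True
    then show ?thesis using matching_weight by simp
  next
    case False
    have "\<not> prefix block_pattern (replicate k [] @ us)" for us
    proof
      assume "prefix block_pattern (replicate k [] @ us)"
      then obtain ws where "replicate k [] @ us = block_pattern @ ws" by (auto simp: prefix_def)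
      then have "(replicate k [] @ us) ! (b - 1) = (block_pattern @ ws) ! (b - 1)" by simp
      \<comment> \<open>Index \<open>b - 1\<close> of \<open>block_pattern\<close> holds the
        nonempty \<rho>, but here it falls among the empty words.\<close>
      moreover have "b - 1 < k" using False b by simp
      ultimately show False using \<rho>(2) by (simp add: block_pattern_def nth_append)
    qed
    then have "?m = (\<lambda>us. 0)" by simp
    then show ?thesis using False by (simp add: fps_infsum_def flip: fps_zero_def)
  qed
  finally show ?thesis .
qed

lemma G_0: "G 0 = F + (q - 1) * fps_X ^ (b + length \<rho>) * G (a - 1)"
  using G_eq[of 0] b by (simp add: F_assemble mult_ac)

text \<open>An empty last segment consists of its opening 1 alone, which serves as the term
  following the remaining sequence. The second summand accounts for occurrences completed by the
  next term.\<close>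

lemma G_Suc: "G (Suc k) = fps_X * G k + (q - 1) * (of_bool (Suc k < b) * fps_X ^ (b + length \<rho>) * G (a - 1))"
proof -
  have "fps_infsum (\<lambda>us. weight (assemble (replicate (Suc k) [] @ us))) (lists NCW) =
    fps_infsum (\<lambda>us. fps_X * seq_weight (replicate k [] @ us)) (lists NCW)"
  proof (rule fps_infsum_cong)
    fix us assume "us \<in> lists NCW"
    then have "replicate k [] @ us \<in> lists NCW" using Nil_in_NCW by auto
    then show "weight (assemble (replicate (Suc k) [] @ us)) = fps_X * seq_weight (replicate k [] @ us)"
      using weight_assemble_Cons[OF _ Nil_in_NCW] by (simp add: weight_Nil del: assemble.simps)
  qed
  also have "\<dots> = fps_X * G k"
    unfolding G_def using Nil_in_NCW by (intro fps_infsum_cmult locally_finite_append locally_finite_seq_weight) auto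
  finally show ?thesis using G_eq[of "Suc k"] by simp
qed

end

subsection \<open>Solving the equations\<close>

text \<open>The two roots have a sum with constant term 2, so in the factored difference of squares
  the other factor vanishes.\<close>

lemma fps_sqrt1_unique:
  fixes f h :: "'a::field_char_0 fps"
  assumes "h ^ 2 = f" "h $ 0 = 1"
  shows "fps_sqrt1 f = h"
proof -
  have "f $ 0 = 1" using assms by (auto simp: power2_eq_square)
  then have "(fps_sqrt1 f - h) * (fps_sqrt1 f + h) = 0"
    using fps_sqrt1_square[of f] assms(1) by (simp add: algebra_simps power2_eq_square)
  moreover have "(fps_sqrt1 f + h) $ 0 \<noteq> 0" using assms(2) by (simp add: fps_sqrt1_nth_0)
  then have "fps_sqrt1 f + h \<noteq> 0" by (metis fps_zero_nth)
  ultimately show ?thesis by simp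
qed

lemma fps_quadratic_solution:
  fixes A B F :: "'a::field_char_0 fps"
  assumes eq: "B * (F - 1) = fps_X * A * F ^ 2" and A: "A $ 0 \<noteq> 0" and B: "B $ 0 \<noteq> 0"
  shows "F = (B * (1 - fps_sqrt1 (1 - (4 * fps_X * A) / B))) / (2 * fps_X * A)"
proof -
  define C where "C = inverse B"
  have C: "B * C = 1" using B by (simp add: C_def inverse_mult_eq_1')
  \<comment> \<open>Completing the square suggests this root, and its constant term 1 selects the
    branch.\<close>
  define h where "h = 1 - 2 * fps_X * A * F * C"
  have "h ^ 2 = 1 - 4 * fps_X * A * F * C + 4 * fps_X * A * C * C * (fps_X * A * F ^ 2)"
    by (simp add: h_def power2_eq_square algebra_simps)
  also have "\<dots> = 1 - 4 * fps_X * A * F * C + 4 * fps_X * A * C * (B * C) * (F - 1)"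
    unfolding eq[symmetric] by (simp add: algebra_simps)
  also have "\<dots> = 1 - 4 * fps_X * A / B"
    unfolding C by (simp add: fps_divide_unit[OF B] C_def[symmetric] algebra_simps)
  finally have "h ^ 2 = 1 - 4 * fps_X * A / B" .
  then have "fps_sqrt1 (1 - (4 * fps_X * A) / B) = h"
    by (rule fps_sqrt1_unique) (simp add: h_def)
  moreover have "B * (1 - h) = (B * C) * (F * (2 * fps_X * A))"
    by (simp add: h_def algebra_simps)
  \<comment> \<open>The denominator is not a unit because of \<open>fps_X\<close>, but it divides
    the numerator exactly.\<close>
  then have "B * (1 - h) = F * (2 * fps_X * A)" by (simp add: C)
  moreover have "2 * fps_X * A \<noteq> 0" using A by auto
  ultimately show ?thesis by simp
qed

section \<open>Elimination of the auxiliary series\<close>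

context subword_pattern
begin

text \<open>Iterating \<open>G_Suc\<close> yields a geometric sum in \<open>fps_X\<close>; the
  factor \<open>1 - fps_X\<close> clears its denominator.\<close>

lemma G_below:
  assumes "k < b"
  shows "(1 - fps_X) * G k = (1 - fps_X) * fps_X ^ k * G 0 +
    (q - 1) * (1 - fps_X ^ k) * fps_X ^ (b + length \<rho>) * G (a - 1)"
  using assms
proof (induction k)
  case (Suc k)
  define y where "y = fps_X ^ (b + length \<rho>) * G (a - 1)"
  have "(1 - fps_X) * G (Suc k) = fps_X * ((1 - fps_X) * G k) + (1 - fps_X) * (q - 1) * y"
    using Suc.prems by (simp add: G_Suc y_def algebra_simps)
  also have "(1 - fps_X) * G k = (1 - fps_X) * fps_X ^ k * G 0 + (q - 1) * (1 - fps_X ^ k) * y"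
    using Suc by (simp add: y_def mult.assoc)
  finally show ?case unfolding y_def[symmetric] mult.assoc[of _ "fps_X ^ (b + length \<rho>)"]
    by (simp add: algebra_simps)
qed simp

text \<open>With \<open>b\<close> or more empty words at the end no match is possible, so each
  further one only multiplies by \<open>fps_X\<close>.\<close>

lemma G_above: "G (b - 1 + i) = fps_X ^ i * G (b - 1)"
proof (induction i)
  case (Suc i)
  then show ?case using G_Suc[of "b - 1 + i"] b by (simp add: mult_ac)
qed simp

text \<open>For \<open>a \<le> b\<close> this is \<open>G_below\<close>. Otherwise
  \<open>b - 1\<close> steps come from \<open>G_below\<close> and the remaining \<open>a - b\<close>
  from \<open>G_above\<close>, which raises the exponent from \<open>b\<close> to \<open>a\<close>.
  This is how the minimum and the maximum enter.\<close>

lemma G_last: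
  "(1 - fps_X) * G (a - 1) = (1 - fps_X) * fps_X ^ (a - 1) * G 0 +
    (q - 1) * (1 - fps_X ^ (min a b - 1)) * fps_X ^ (length \<rho> + max a b) * G (a - 1)"
proof (cases "a \<le> b")
  case True
  then show ?thesis using G_below[of "a - 1"] a by (simp add: add.commute)
next
  case False
  then have i: "a - 1 = b - 1 + (a - b)" using b by simp
  define K where "K = G (a - 1)"
  have "(1 - fps_X) * K = fps_X ^ (a - b) * ((1 - fps_X) * G (b - 1))"
    unfolding K_def i G_above by (simp add: mult_ac)
  also have "\<dots> = (1 - fps_X) * (fps_X ^ (b - 1) * fps_X ^ (a - b)) * G 0 +
    (q - 1) * (1 - fps_X ^ (b - 1)) * (fps_X ^ (a - b) * fps_X ^ (b + length \<rho>)) * K"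
    by (subst G_below) (use b in \<open>simp_all add: K_def algebra_simps\<close>)
  also have "fps_X ^ (b - 1) * fps_X ^ (a - b) = (fps_X ^ (a - 1) :: rat poly fract fps)"
    by (simp only: i power_add)
  also have "fps_X ^ (a - b) * fps_X ^ (b + length \<rho>) = (fps_X ^ (length \<rho> + max a b) :: rat poly fract fps)"
    using False by (simp flip: power_add)
  finally show ?thesis using False by (simp add: K_def)
qed

lemma F_quadratic:
  fixes A B :: "rat poly fract fps"
  defines "A \<equiv> 1 - fps_X + (1 - q) * (1 - fps_X ^ (min a b - 1)) * fps_X ^ (length \<rho> + max a b)"
    and "B \<equiv> 1 - fps_X + (1 - q) * (1 - fps_X ^ min a b) * fps_X ^ (length \<rho> + max a b)"
  shows "B * (F - 1) = fps_X * A * F ^ 2"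
proof -
  define s T where "s = min a b - 1" and "T = (fps_X ^ (length \<rho> + max a b) :: rat poly fract fps)"
  define K where "K = G (a - 1)"
  have s: "min a b = Suc s" using a b by (simp add: s_def)
  \<comment> \<open>The sum of \<open>a\<close> and \<open>b\<close> is the sum of their minimum and
    maximum.\<close>
  have exps: "b + length \<rho> + (a - 1) = s + (length \<rho> + max a b)"
    using a b by (auto simp: s_def min_def max_def)
  have AK: "A * K = (1 - fps_X) * fps_X ^ (a - 1) * G 0"
    using G_last unfolding A_def K_def by (simp add: algebra_simps)
  \<comment> \<open>This is \<open>1 - fps_X ^ Suc s\<close> written as
    \<open>(1 - fps_X ^ s) + (1 - fps_X) * fps_X ^ s\<close>.\<close>
  have BA: "B = A + (1 - q) * (1 - fps_X) * fps_X ^ s * T"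
    unfolding A_def B_def s by (simp add: T_def algebra_simps)
  \<comment> \<open>Multiplying \<open>G_0\<close> by \<open>A\<close> makes \<open>K\<close> appear
    only as \<open>A * K\<close>, which \<open>AK\<close> replaces without a division.\<close>
  have "A * F = A * G 0 + (1 - q) * fps_X ^ (b + length \<rho>) * (A * K)"
    unfolding G_0 K_def by (simp add: algebra_simps)
  also have "\<dots> = A * G 0 + (1 - q) * (1 - fps_X) * fps_X ^ (b + length \<rho> + (a - 1)) * G 0"
    unfolding AK by (simp add: power_add mult_ac)
  also have "\<dots> = B * G 0"
    unfolding exps BA T_def by (simp add: power_add algebra_simps)
  finally have AF: "A * F = B * G 0" .
  have "F - 1 = fps_X * F * G 0" using F_eq by (simp only: diff_eq_eq add.commute)
  then have "B * (F - 1) = fps_X * F * (B * G 0)" by (simp add: mult_ac)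
  then show ?thesis by (simp add: power2_eq_square mult_ac flip: AF)
qed

end

theorem theorem6:
  fixes a b m s t :: nat and \<rho> \<tau> :: "nat list" and q x :: "rat poly fract fps"
  assumes "a \<ge> 1" and "b \<ge> 1" and "m \<ge> 1"
    and "\<rho> \<in> NC m"
    and "\<tau> = replicate a 1 @ map (\<lambda>c. c + 1) \<rho> @ replicate b 1"
    and "s = min a b" and "t = max a b"
    and "q = fps_const qvar" and "x = fps_X"
  shows "NC_gf \<tau> =
    ((1 - x + (1 - q) * (1 - x ^ s) * x ^ (m + t)) *
     (1 - fps_sqrt1 (1 - (4 * x * (1 - x + (1 - q) * (1 - x ^ (s - 1)) * x ^ (m + t))) /
                         (1 - x + (1 - q) * (1 - x ^ s) * x ^ (m + t))))) /
    (2 * x * (1 - x + (1 - q) * (1 - x ^ (s - 1)) * x ^ (m + t)))"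
proof -
  have m: "length \<rho> = m" and \<rho>: "\<rho> \<in> NCW"
    using assms(4) length_NC NC_subset_NCW by blast+
  interpret subword_pattern a b \<rho>
    using assms(1-3) m \<rho> by unfold_locales auto
  have \<tau>_eq: "subword_pattern.\<tau> a b \<rho> = \<tau>" using \<tau>_def assms(5) by simp
  \<comment> \<open>The exponent is positive, so both polynomial expressions have constant term 1
    and are units.\<close>
  obtain k where "m + t = Suc k" using assms(3) by (cases "m + t") auto
  then have unit: "(1 - x + (1 - q) * c * x ^ (m + t)) $ 0 \<noteq> 0" for c
    by (simp only: assms(9)) simp
  have "NC_gf \<tau> = F" using NC_gf_eq by (simp add: F_def \<tau>_eq)
  then show ?thesis
    using fps_quadratic_solution[OF F_quadratic[unfolded m] unit[of "1 - x ^ (s - 1)", unfolded assms(6-9)]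
        unit[of "1 - x ^ s", unfolded assms(6-9)]]
    by (simp only: assms(6-9))
qed

end
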